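(* Let $d\ge 1$ and let $U:\mathbb{R}^d\to\mathbb{R}^+$ be a $C^1$ function with $\int_{\mathbb{R}^d} e^{-U(\mathbf{x})}\,d\mathbf{x}<\infty$, and let $\pi(d\mathbf{x})\propto e^{-U(\mathbf{x})}d\mathbf{x}$. For any constant $\lambda^{\mathrm{ref}}>0$, the Coordinate Sampler piecewise deterministic Markov process $(\mathbf{X}_t,\mathbf{V}_t)_{t\ge 0}$ on $\mathbb{R}^d\times\mathcal{V}$ (defined in the context) admits $\rho(d\mathbf{x},d\mathbf{v})=\pi(d\mathbf{x})\varphi(d\mathbf{v})$ as an invariant distribution, and this invariant distribution is unique.
   Context: Let $e_1,\dots,e_d$ be the standard basis of $\mathbb{R}^d$ and $\mathcal{V}=\{\pm e_i: i=1,\dots,d\}$ (a set of $2d$ velocities); $\varphi$ denotes the uniform distribution on $\mathcal{V}$. For $a\in\mathbb{R}$ write $a_+=\max(a,0)$. The Coordinate Sampler is the piecewise deterministic Markov process $\mathbf{Z}_t=(\mathbf{X}_t,\mathbf{V}_t)$ on $\mathbb{R}^d\times\mathcal{V}$ with the following three ingredients: (i) Deterministic dynamic between events: $\frac{d\mathbf{X}_t}{dt}=\mathbf{V}_t$, $\frac{d\mathbf{V}_t}{dt}=0$ (so the position moves linearly along a single coordinate direction). (ii) Event rate: events occur as an inhomogeneous Poisson process with rate $\lambda(\mathbf{X}_t,\mathbf{V}_t)$, where $\lambda(\mathbf{x},\mathbf{v})=\langle \mathbf{v},\nabla U(\mathbf{x})\rangle_+ +\lambda^{\mathrm{ref}}$.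 (iii) Transition at an event time with pre-event state $(\mathbf{x},\mathbf{v})$: the position is unchanged and the new velocity is $\mathbf{v}^*\in\mathcal{V}$ with probability $\lambda(\mathbf{x},-\mathbf{v}^* )/\lambda(\mathbf{x})$, where $\lambda(\mathbf{x})=\sum_{\mathbf{w}\in\mathcal{V}}\lambda(\mathbf{x},\mathbf{w})=2d\lambda^{\mathrm{ref}}+\sum_{i=1}^d\left|\frac{\partial U(\mathbf{x})}{\partial x_i}\right|$. That is, $Q((d\mathbf{x}',d\mathbf{v}')\mid(\mathbf{x},\mathbf{v}))=\sum_{\mathbf{v}^*\in\mathcal{V}}\frac{\lambda(\mathbf{x},-\mathbf{v}^* )}{\lambda(\mathbf{x})}\delta_{\mathbf{x}}(d\mathbf{x}')\delta_{\mathbf{v}^*}(d\mathbf{v}')$. *)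

theory Defs
  imports "HOL-Probability.Probability"
begin

text \<open>Velocities: the set V = {+e_i, -e_i} is encoded by the type 'd \<times> bool;
  (i, True) stands for +e_i and (i, False) for -e_i.\<close>

definition vel :: "'d::finite \<times> bool \<Rightarrow> (real^'d)" where
  "vel w = (if snd w then 1 else -1) *\<^sub>R axis (fst w) 1"

definition flipv :: "'d \<times> bool \<Rightarrow> 'd \<times> bool" where
  "flipv w = (fst w, \<not> snd w)"

text \<open>Event rate lambda(x,v) = <v, grad U(x)>_+ + lambda_ref; G is the gradient of U.\<close>
definition rate :: "((real^'d::finite) \<Rightarrow> (real^'d)) \<Rightarrow> real \<Rightarrow> (real^'d) \<Rightarrow> 'd \<times> bool \<Rightarrow> real" where
  "rate G lr x w = max 0 (vel w \<bullet> G x) + lr"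

definition total_rate :: "((real^'d::finite) \<Rightarrow> (real^'d)) \<Rightarrow> real \<Rightarrow> (real^'d) \<Rightarrow> real" where
  "total_rate G lr x = (\<Sum>w\<in>UNIV. rate G lr x w)"

definition jump_prob :: "((real^'d::finite) \<Rightarrow> (real^'d)) \<Rightarrow> real \<Rightarrow> (real^'d) \<Rightarrow> 'd \<times> bool \<Rightarrow> real" where
  "jump_prob G lr x w' = rate G lr x (flipv w') / total_rate G lr x"

definition survival :: "((real^'d::finite) \<Rightarrow> (real^'d)) \<Rightarrow> real \<Rightarrow> real \<Rightarrow> (real^'d) \<times> ('d \<times> bool) \<Rightarrow> real" where
  "survival G lr t z = exp (- integral {0..t} (\<lambda>s. rate G lr (fst z + s *\<^sub>R vel (snd z)) (snd z)))"

text \<open>Kn n t z A: probability that, started at z, the process has exactly n events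
  in [0,t] and lies in A at time t.\<close>
fun Kn :: "((real^'d::finite) \<Rightarrow> (real^'d)) \<Rightarrow> real \<Rightarrow> nat \<Rightarrow> real \<Rightarrow> (real^'d) \<times> ('d \<times> bool)
            \<Rightarrow> ((real^'d) \<times> ('d \<times> bool)) set \<Rightarrow> ennreal" where
  "Kn G lr 0 t z A =
     ennreal (survival G lr t z) * indicator A (fst z + t *\<^sub>R vel (snd z), snd z)"
| "Kn G lr (Suc n) t z A =
     (\<integral>\<^sup>+ s\<in>{0..t}.
        ennreal (survival G lr s z * rate G lr (fst z + s *\<^sub>R vel (snd z)) (snd z)) *
        (\<Sum>w\<in>UNIV. ennreal (jump_prob G lr (fst z + s *\<^sub>R vel (snd z)) w) *
                   Kn G lr n (t - s) (fst z + s *\<^sub>R vel (snd z), w) A) \<partial>lborel)"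

definition trans :: "((real^'d::finite) \<Rightarrow> (real^'d)) \<Rightarrow> real \<Rightarrow> real \<Rightarrow> (real^'d) \<times> ('d \<times> bool)
            \<Rightarrow> ((real^'d) \<times> ('d \<times> bool)) set \<Rightarrow> ennreal" where
  "trans G lr t z A = (\<Sum>n. Kn G lr n t z A)"

definition stateM :: "((real^'d::finite) \<times> ('d \<times> bool)) measure" where
  "stateM = lborel \<Otimes>\<^sub>M count_space UNIV"

definition invariant :: "((real^'d::finite) \<Rightarrow> (real^'d)) \<Rightarrow> real \<Rightarrow> ((real^'d) \<times> ('d \<times> bool)) measure \<Rightarrow> bool" where
  "invariant G lr \<mu> \<longleftrightarrow> prob_space \<mu> \<and> sets \<mu> = sets stateM \<and>
     (\<forall>t\<ge>0. \<forall>A\<in>sets stateM. (\<integral>\<^sup>+ z. trans G lr t z A \<partial>\<mu>) = emeasure \<mu> A)"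

definition target :: "((real^'d::finite) \<Rightarrow> real) \<Rightarrow> (real^'d) measure" where
  "target U = density lborel (\<lambda>x. ennreal (exp (- U x) / (\<integral>y. exp (- U y) \<partial>lborel)))"

definition rho :: "((real^'d::finite) \<Rightarrow> real) \<Rightarrow> ((real^'d) \<times> ('d \<times> bool)) measure" where
  "rho U = target U \<Otimes>\<^sub>M uniform_count_measure UNIV"

end

theory Submission
  imports Defs
begin

text \<open>
  Write \<open>P\<^sub>s\<close> (\<open>P0\<close> below) for free flight during time \<open>s\<close> without an event and \<open>J\<close> for the jump intensity, so that
  the kernel with exactly \<open>n\<close> events is the time-ordered integral of \<open>P J P \<dots> J P\<close>. On paths of length
  \<open>t\<close> the rate is bounded, hence the process does not explode.

  Invariance: with respect to the weight \<open>exp (- U)\<close> the adjoints of \<open>P\<^sub>s\<close> and \<open>J\<close> are their conjugates by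
  the velocity flip, since \<open>\<lambda>(x,v) - \<lambda>(x,-v)\<close> is the derivative of \<open>U\<close> along \<open>v\<close> and since the jump
  intensity from \<open>v\<close> to \<open>w\<close>, \<open>\<lambda>(x,v) \<lambda>(x,-w) / \<lambda>(x)\<close>, is symmetric under \<open>(v,w) \<mapsto> (-w,-v)\<close>.
  So the same holds for every \<open>n\<close>-event kernel, and summing over \<open>n\<close> gives invariance.

  Uniqueness: as \<open>lr > 0\<close>, every velocity is available at all times; one jump per coordinate
  reaches almost every position, so the resolvent charges every set of positive Lebesgue measure from every
  starting point. If \<open>Y\<close> is the positive Hahn set of the difference of two invariant laws, then \<open>Y\<close> or its
  complement is charged from everywhere, and balancing the flow between the two forces the laws to agree.
\<close>

subsection \<open>State space and flow\<close>

lemma sets_stateM [measurable_cong]: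
  "sets (stateM :: ((real^'d::finite) \<times> ('d \<times> bool)) measure) = sets (borel \<Otimes>\<^sub>M count_space UNIV)"
  unfolding stateM_def by (intro sets_pair_measure_cong) auto

lemma space_stateM [simp]: "space stateM = UNIV"
  by (simp add: stateM_def space_pair_measure)

lemma measurable_vel [measurable]: "vel \<in> borel_measurable (count_space UNIV)"
  by simp

lemma measurable_flipv [measurable]: "flipv \<in> measurable (count_space UNIV) (count_space UNIV)"
  by simp

lemma flipv_flipv [simp]: "flipv (flipv w) = w"
  by (simp add: flipv_def)

lemma vel_flipv: "vel (flipv w) = - vel w"
  by (simp add: flipv_def vel_def)

lemma norm_vel [simp]: "norm (vel w) = 1"
  by (simp add: vel_def norm_axis_1)

lemma sum_flipv: "(\<Sum>w\<in>UNIV. f (flipv w)) = (\<Sum>w\<in>UNIV. f w)"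
  by (rule sum.reindex_bij_witness[where i=flipv and j=flipv]) auto

interpretation stateM: sigma_finite_measure "stateM :: ((real^'d::finite) \<times> ('d \<times> bool)) measure"
proof -
  interpret pair_sigma_finite "lborel :: (real^'d) measure" "count_space (UNIV :: ('d \<times> bool) set)"
    by (intro pair_sigma_finite.intro sigma_finite_lborel sigma_finite_measure_count_space_finite) auto
  show "sigma_finite_measure (stateM :: ((real^'d) \<times> ('d \<times> bool)) measure)"
    unfolding stateM_def by unfold_locales
qed

interpretation lborel_stateM: pair_sigma_finite lborel stateM ..

lemma nn_integral_stateM:
  fixes f :: "(real^'d::finite) \<times> ('d \<times> bool) \<Rightarrow> ennreal"
  assumes f [measurable]: "f \<in> borel_measurable stateM"
  shows "(\<integral>\<^sup>+ z. f z \<partial>stateM) = (\<Sum>w\<in>UNIV. \<integral>\<^sup>+ x. f (x, w) \<partial>lborel)"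
proof -
  interpret pair_sigma_finite "lborel :: (real^'d) measure" "count_space (UNIV :: ('d \<times> bool) set)"
    by (intro pair_sigma_finite.intro sigma_finite_lborel sigma_finite_measure_count_space_finite) auto
  have "f \<in> borel_measurable (lborel \<Otimes>\<^sub>M count_space UNIV)"
    using f unfolding stateM_def .
  from nn_integral_snd[OF this] show ?thesis
    unfolding stateM_def by (simp add: nn_integral_count_space_finite)
qed

lemma nn_integral_lborel_shift:
  fixes f :: "'a::euclidean_space \<Rightarrow> ennreal"
  assumes [measurable]: "f \<in> borel_measurable borel"
  shows "(\<integral>\<^sup>+ x. f (c + x) \<partial>lborel) = (\<integral>\<^sup>+ x. f x \<partial>lborel)"
  by (subst (2) lborel_distr_plus[of c, symmetric]) (simp add: nn_integral_distr)

definition flow :: "real \<Rightarrow> (real^'d::finite) \<times> ('d \<times> bool) \<Rightarrow> (real^'d) \<times> ('d \<times> bool)" where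
  "flow s z = (fst z + s *\<^sub>R vel (snd z), snd z)"

definition flipz :: "(real^'d::finite) \<times> ('d \<times> bool) \<Rightarrow> (real^'d) \<times> ('d \<times> bool)" where
  "flipz z = (fst z, flipv (snd z))"

lemma measurable_flow [measurable (raw)]:
  assumes [measurable]: "f \<in> borel_measurable M" "g \<in> measurable M stateM"
  shows "(\<lambda>x. flow (f x) (g x)) \<in> measurable M stateM"
proof -
  have [measurable]: "g \<in> measurable M (borel \<Otimes>\<^sub>M count_space UNIV)"
    using assms(2) by (simp cong: measurable_cong_sets add: measurable_cong_sets[OF refl sets_stateM])
  have "(\<lambda>x. flow (f x) (g x)) \<in> measurable M (borel \<Otimes>\<^sub>M count_space UNIV)"
    unfolding flow_def by measurable
  then show ?thesis by (simp add: measurable_cong_sets[OF refl sets_stateM])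
qed

lemma measurable_flipz [measurable]: "flipz \<in> measurable stateM stateM"
  unfolding flipz_def by measurable

lemma flipz_flipz [simp]: "flipz (flipz z) = z"
  by (simp add: flipz_def)

lemma flow_0 [simp]: "flow 0 z = z"
  by (simp add: flow_def)

lemma snd_flow [simp]: "snd (flow s z) = snd z"
  by (simp add: flow_def)

subsection \<open>Kernels\<close>

locale coordinate_sampler =
  fixes G :: "(real^'d::finite) \<Rightarrow> (real^'d)" and lr :: real
  assumes G_cont: "continuous_on UNIV G" and lr_pos: "lr > 0"
begin

abbreviation ratez :: "(real^'d) \<times> ('d \<times> bool) \<Rightarrow> real" where
  "ratez z \<equiv> rate G lr (fst z) (snd z)"

definition P0 :: "real \<Rightarrow> ((real^'d) \<times> ('d \<times> bool) \<Rightarrow> ennreal) \<Rightarrow> (real^'d) \<times> ('d \<times> bool) \<Rightarrow> ennreal" where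
  "P0 s f z = ennreal (survival G lr s z) * f (flow s z)"

definition J :: "((real^'d) \<times> ('d \<times> bool) \<Rightarrow> ennreal) \<Rightarrow> (real^'d) \<times> ('d \<times> bool) \<Rightarrow> ennreal" where
  "J f z = ennreal (ratez z) * (\<Sum>w\<in>UNIV. ennreal (jump_prob G lr (fst z) w) * f (fst z, w))"

text \<open>Test functions in place of sets turn the kernels into operators that compose with
  \<open>P0\<close> and \<open>J\<close> and can be moved across an integral; indicators give back
  \<open>Kn\<close>.\<close>

primrec K :: "nat \<Rightarrow> real \<Rightarrow> ((real^'d) \<times> ('d \<times> bool) \<Rightarrow> ennreal) \<Rightarrow> (real^'d) \<times> ('d \<times> bool) \<Rightarrow> ennreal" where
  "K 0 t f z = P0 t f z"
| "K (Suc n) t f z = (\<integral>\<^sup>+ s\<in>{0..t}. P0 s (J (K n (t - s) f)) z \<partial>lborel)"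

section \<open>Positivity, continuity and measurability of rates and kernels\<close>

lemma G_measurable [measurable]: "G \<in> borel_measurable borel"
  using G_cont by (rule borel_measurable_continuous_onI)

lemma rate_ge: "rate G lr x w \<ge> lr"
  by (simp add: rate_def)

lemma rate_pos: "rate G lr x w > 0"
  using rate_ge[of x w] lr_pos by linarith

lemma rate_nonneg [simp]: "rate G lr x w \<ge> 0"
  using rate_pos[of x w] by linarith

lemma total_rate_pos: "total_rate G lr x > 0"
  unfolding total_rate_def by (intro sum_pos rate_pos) auto

lemma jump_prob_pos: "jump_prob G lr x w > 0"
  unfolding jump_prob_def by (intro divide_pos_pos rate_pos total_rate_pos)

lemma jump_prob_nonneg [simp]: "jump_prob G lr x w \<ge> 0"
  using jump_prob_pos[of x w] by linarith

lemma sum_jump_prob: "(\<Sum>w\<in>UNIV. jump_prob G lr x w) = 1"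
proof -
  have "(\<Sum>w\<in>UNIV. rate G lr x (flipv w)) = total_rate G lr x"
    unfolding total_rate_def by (rule sum_flipv)
  then show ?thesis
    using total_rate_pos[of x] by (simp add: jump_prob_def flip: sum_divide_distrib)
qed

lemma continuous_rate: "continuous_on UNIV (\<lambda>x. rate G lr x w)"
  unfolding rate_def by (intro continuous_intros G_cont)

lemma continuous_rate_flow: "continuous_on S (\<lambda>s. ratez (flow s z))"
proof -
  have "continuous_on UNIV ((\<lambda>x. rate G lr x (snd z)) \<circ> (\<lambda>s. fst z + s *\<^sub>R vel (snd z)))"
    by (intro continuous_on_compose continuous_intros continuous_on_subset[OF continuous_rate]) auto
  then show ?thesis
    by (auto simp: o_def flow_def intro: continuous_on_subset)
qed

lemma survival_flow: "survival G lr t z = exp (- integral {0..t} (\<lambda>s. ratez (flow s z)))"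
  by (simp add: survival_def flow_def)

lemma integral_rate_nonneg: "0 \<le> integral {0..t} (\<lambda>s. ratez (flow s z))"
  by (intro integral_nonneg integrable_continuous_real continuous_rate_flow rate_nonneg)

lemma survival_pos: "survival G lr t z > 0"
  by (simp add: survival_def)

lemma survival_nonneg [simp]: "survival G lr t z \<ge> 0"
  by (simp add: survival_def)

lemma survival_le_1: "survival G lr t z \<le> 1"
  unfolding survival_flow by (simp add: integral_rate_nonneg del: snd_flow)

lemma measurable_rate [measurable (raw)]:
  assumes [measurable]: "f \<in> borel_measurable M" "g \<in> measurable M (count_space UNIV)"
  shows "(\<lambda>x. rate G lr (f x) (g x)) \<in> borel_measurable M"
  unfolding rate_def by measurable

lemma measurable_jump_prob [measurable (raw)]:
  assumes [measurable]: "f \<in> borel_measurable M" "g \<in> measurable M (count_space UNIV)"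
  shows "(\<lambda>x. jump_prob G lr (f x) (g x)) \<in> borel_measurable M"
  unfolding jump_prob_def total_rate_def by measurable

text \<open>Passing from the gauge integral in \<open>survival\<close> to a Lebesgue integral yields
  joint measurability in \<open>(t, z)\<close> through Fubini, and later the reflection of time in
  \<open>survival_reversal\<close>.\<close>

lemma integral_rate_flow:
  "integral {0..t} (\<lambda>s. ratez (flow s z)) = enn2real (\<integral>\<^sup>+ s\<in>{0..t}. ennreal (ratez (flow s z)) \<partial>lborel)"
proof -
  have "((\<lambda>s. ratez (flow s z)) has_integral integral {0..t} (\<lambda>s. ratez (flow s z))) {0..t}"
    by (intro integrable_integral integrable_continuous_real continuous_rate_flow)
  from nn_integral_has_integral_lebesgue'[OF _ this] show ?thesis
    by (simp add: integral_rate_nonneg del: snd_flow)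
qed

lemma fst_measurable_stateM [measurable (raw)]:
  assumes "f \<in> measurable M stateM"
  shows "(\<lambda>x. fst (f x)) \<in> borel_measurable M"
  using assms by (subst (asm) measurable_cong_sets[OF refl sets_stateM]) measurable

lemma snd_measurable_stateM [measurable (raw)]:
  assumes "f \<in> measurable M stateM"
  shows "(\<lambda>x. snd (f x)) \<in> measurable M (count_space UNIV)"
  using assms by (subst (asm) measurable_cong_sets[OF refl sets_stateM]) measurable

lemma Pair_measurable_stateM [measurable (raw)]:
  assumes [measurable]: "f \<in> borel_measurable M" "g \<in> measurable M (count_space UNIV)"
  shows "(\<lambda>x. (f x, g x)) \<in> measurable M stateM"
  by (subst measurable_cong_sets[OF refl sets_stateM]) measurable

lemma measurable_survival [measurable (raw)]:
  assumes [measurable]: "f \<in> borel_measurable M" "g \<in> measurable M stateM"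
  shows "(\<lambda>x. survival G lr (f x) (g x)) \<in> borel_measurable M"
  unfolding survival_flow integral_rate_flow indicator_def atLeastAtMost_iff by measurable

lemma measurable_P0 [measurable (raw)]:
  assumes [measurable]: "f \<in> borel_measurable M" "g \<in> measurable M stateM"
    "(\<lambda>(x, z). F x z) \<in> borel_measurable (M \<Otimes>\<^sub>M stateM)"
  shows "(\<lambda>x. P0 (f x) (F x) (g x)) \<in> borel_measurable M"
  unfolding P0_def by measurable

lemma measurable_J [measurable (raw)]:
  assumes [measurable]: "g \<in> measurable M stateM"
    "(\<lambda>(x, z). F x z) \<in> borel_measurable (M \<Otimes>\<^sub>M stateM)"
  shows "(\<lambda>x. J (F x) (g x)) \<in> borel_measurable M"
  unfolding J_def by measurable

text \<open>The parameter \<open>p\<close> lets the test function vary with an integration variable,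
  as in the integral of \<open>K n (t - r) (J (P0 r f))\<close> over \<open>r\<close>.\<close>

lemma measurable_K_param:
  assumes [measurable]: "(\<lambda>(p, z). F p z) \<in> borel_measurable (N \<Otimes>\<^sub>M stateM)"
  shows "(\<lambda>(p, t, z). K n t (F p) z) \<in> borel_measurable (N \<Otimes>\<^sub>M (borel \<Otimes>\<^sub>M stateM))"
proof (induction n)
  case 0
  show ?case unfolding K.simps by measurable
next
  case (Suc n)
  note [measurable] = Suc.IH
  have [measurable]: "(\<lambda>x. K n (f x) (F (h x)) (g x)) \<in> borel_measurable M"
    if [measurable]: "f \<in> borel_measurable M" "g \<in> measurable M stateM" "h \<in> measurable M N"
    for M :: "'x measure" and f g h
    using measurable_compose[OF _ Suc.IH, of "\<lambda>x. (h x, f x, g x)" M] by simp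
  show ?case
    unfolding K.simps indicator_def atLeastAtMost_iff by measurable
qed

lemma measurable_K [measurable (raw)]:
  assumes [measurable]: "f \<in> borel_measurable M" "g \<in> measurable M stateM"
    and F: "(\<lambda>(x, z). F x z) \<in> borel_measurable (M \<Otimes>\<^sub>M stateM)"
  shows "(\<lambda>x. K n (f x) (F x) (g x)) \<in> borel_measurable M"
  using measurable_compose[OF _ measurable_K_param[OF F], of "\<lambda>x. (x, f x, g x)" M] by simp

lemma Kn_eq_K: "Kn G lr n t z A = K n t (indicator A) z"
proof (induction n arbitrary: t z)
  case 0
  then show ?case by (simp add: P0_def flow_def)
next
  case (Suc n)
  show ?case
    by (simp add: Suc P0_def J_def flow_def ennreal_mult mult.assoc)
qed

lemma trans_eq: "trans G lr t z A = (\<Sum>n. K n t (indicator A) z)"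
  by (simp add: trans_def Kn_eq_K)

end

subsection \<open>Non-explosion\<close>

context coordinate_sampler
begin

text \<open>The integrand is the density of the first event time, being minus the derivative of
  \<open>survival\<close>. So the first event falls either after \<open>t\<close> or within
  \<open>[0,t]\<close>, with total probability 1.\<close>

lemma survival_FTC:
  assumes "0 \<le> t"
  shows "ennreal (survival G lr t z) + (\<integral>\<^sup>+ s\<in>{0..t}. ennreal (survival G lr s z * ratez (flow s z)) \<partial>lborel) = 1"
proof -
  have deriv: "((\<lambda>s. - survival G lr s z) has_vector_derivative survival G lr s z * ratez (flow s z)) (at s within {0..t})"
    if s: "s \<in> {0..t}" for s
  proof -
    have "((\<lambda>s. integral {0..s} (\<lambda>s. ratez (flow s z))) has_real_derivative ratez (flow s z)) (at s within {0..t})"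
      by (intro integral_has_real_derivative continuous_rate_flow s)
    then have "((\<lambda>s. - survival G lr s z) has_real_derivative survival G lr s z * ratez (flow s z)) (at s within {0..t})"
      unfolding survival_flow by (auto intro!: derivative_eq_intros)
    then show ?thesis
      by (simp add: has_real_derivative_iff_has_vector_derivative)
  qed
  have "((\<lambda>s. survival G lr s z * ratez (flow s z)) has_integral - survival G lr t z - - survival G lr 0 z) {0..t}"
    by (intro fundamental_theorem_of_calculus deriv assms)
  from nn_integral_has_integral_lebesgue'[OF _ this]
  have "(\<integral>\<^sup>+ s\<in>{0..t}. ennreal (survival G lr s z * ratez (flow s z)) \<partial>lborel)
      = ennreal (survival G lr 0 z - survival G lr t z)"
    by simp
  moreover have "survival G lr 0 z = 1"
    by (simp add: survival_def)
  ultimately show ?thesis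
    using survival_le_1[of t z] by (simp flip: ennreal_plus)
qed

lemma P0_add: "P0 s (\<lambda>z. f z + g z) z = P0 s f z + P0 s g z"
  by (simp add: P0_def distrib_left)

lemma J_add: "J (\<lambda>z. f z + g z) z = J f z + J g z"
  by (simp add: J_def distrib_left sum.distrib)

lemma J_cong: "(\<And>w. f (fst z, w) = g (fst z, w)) \<Longrightarrow> J f z = J g z"
  by (simp add: J_def)

lemma J_const: "J (\<lambda>_. c) z = ennreal (ratez z) * c"
  by (simp add: J_def sum_jump_prob flip: sum_distrib_right)

lemma J_mono: "(\<And>w. f (fst z, w) \<le> g (fst z, w)) \<Longrightarrow> J f z \<le> J g z"
  by (auto simp: J_def intro!: mult_left_mono sum_mono)

lemma P0_le: "P0 s f z \<le> f (flow s z)"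
  using mult_right_mono[of "ennreal (survival G lr s z)" 1 "f (flow s z)"] survival_le_1[of s z]
  by (simp add: P0_def)

text \<open>Probability of at least \<open>n\<close> events in \<open>[0,t]\<close>.\<close>
primrec tail :: "nat \<Rightarrow> real \<Rightarrow> (real^'d) \<times> ('d \<times> bool) \<Rightarrow> ennreal" where
  "tail 0 t z = 1"
| "tail (Suc n) t z = (\<integral>\<^sup>+ s\<in>{0..t}. P0 s (J (tail n (t - s))) z \<partial>lborel)"

lemma measurable_tail_pair: "(\<lambda>(t, z). tail n t z) \<in> borel_measurable (borel \<Otimes>\<^sub>M stateM)"
proof (induction n)
  case 0
  show ?case by simp
next
  case (Suc n)
  note [measurable] = Suc.IH
  show ?case
    unfolding tail.simps indicator_def atLeastAtMost_iff by measurable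
qed

lemma measurable_tail [measurable (raw)]:
  assumes [measurable]: "f \<in> borel_measurable M" "g \<in> measurable M stateM"
  shows "(\<lambda>x. tail n (f x) (g x)) \<in> borel_measurable M"
  using measurable_compose[OF _ measurable_tail_pair, of "\<lambda>x. (f x, g x)" M] by simp

text \<open>Conditioning on the first event reduces \<open>Suc n\<close> to \<open>n\<close> on the
  shorter horizon \<open>t - s\<close>; the base case is \<open>survival_FTC\<close>.\<close>

lemma K_plus_tail:
  assumes "0 \<le> t"
  shows "K n t (\<lambda>_. 1) z + tail (Suc n) t z = tail n t z"
  using assms
proof (induction n arbitrary: t z)
  case 0
  have "tail 0 u = (\<lambda>_. 1)" for u
    by (rule ext) simp
  then have "tail (Suc 0) t z = (\<integral>\<^sup>+ s\<in>{0..t}. ennreal (survival G lr s z * ratez (flow s z)) \<partial>lborel)"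
    by (simp add: J_const P0_def ennreal_mult)
  with survival_FTC[OF 0] show ?case
    by (simp add: P0_def)
next
  case (Suc n)
  have "K (Suc n) t (\<lambda>_. 1) z + tail (Suc (Suc n)) t z =
     (\<integral>\<^sup>+ s. P0 s (J (K n (t - s) (\<lambda>_. 1))) z * indicator {0..t} s
        + P0 s (J (tail (Suc n) (t - s))) z * indicator {0..t} s \<partial>lborel)"
    unfolding K.simps tail.simps(2)[of "Suc n"]
    by (rule nn_integral_add[symmetric]) measurable
  also have "\<dots> = (\<integral>\<^sup>+ s\<in>{0..t}. P0 s (J (tail n (t - s))) z \<partial>lborel)"
  proof (intro nn_integral_cong)
    fix s
    show "P0 s (J (K n (t - s) (\<lambda>_. 1))) z * indicator {0..t} s
        + P0 s (J (tail (Suc n) (t - s))) z * indicator {0..t} s = P0 s (J (tail n (t - s))) z * indicator {0..t} s"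
    proof (cases "s \<in> {0..t}")
      case True
      then have "J (tail n (t - s)) z' = J (\<lambda>z. K n (t - s) (\<lambda>_. 1) z + tail (Suc n) (t - s) z) z'" for z'
        by (intro J_cong) (simp add: Suc.IH del: tail.simps)
      then have "J (tail n (t - s)) = (\<lambda>z. J (K n (t - s) (\<lambda>_. 1)) z + J (tail (Suc n) (t - s)) z)"
        by (simp add: J_add fun_eq_iff del: tail.simps)
      then show ?thesis
        by (simp add: P0_add distrib_right del: tail.simps)
    qed simp
  qed
  finally show ?case by simp
qed

text \<open>Unit speed keeps all paths up to time \<open>t\<close> in the ball where
  \<open>M\<close> bounds the rate, and the ordered \<open>n\<close>-tuples of event times in
  \<open>[0,t]\<close> have volume \<open>t ^ n / fact n\<close>.\<close>

lemma tail_le: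
  assumes "0 \<le> t" "0 \<le> M" "\<And>y w. y \<in> cball (fst z) t \<Longrightarrow> rate G lr y w \<le> M"
  shows "tail n t z \<le> ennreal ((M * t) ^ n / fact n)"
  using assms(1,3)
proof (induction n arbitrary: t z)
  case 0
  show ?case by simp
next
  case (Suc n)
  have "tail (Suc n) t z \<le> (\<integral>\<^sup>+ s\<in>{0..t}. ennreal (M * ((M * (t - s)) ^ n / fact n)) \<partial>lborel)"
    unfolding tail.simps
  proof (intro nn_integral_mono)
    fix s
    show "P0 s (J (tail n (t - s))) z * indicator {0..t} s \<le> ennreal (M * ((M * (t - s)) ^ n / fact n)) * indicator {0..t} s"
    proof (cases "s \<in> {0..t}")
      case True
      \<comment> \<open>What can be reached after an event at time \<open>s\<close> lies in the
        original ball, so the same \<open>M\<close> serves in the induction.\<close>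
      have sub: "cball (fst z + s *\<^sub>R vel (snd z)) (t - s) \<subseteq> cball (fst z) t"
        using True by (subst cball_subset_cball_iff) (simp add: dist_norm)
      have "P0 s (J (tail n (t - s))) z \<le> J (tail n (t - s)) (flow s z)"
        by (rule P0_le)
      also have "\<dots> \<le> J (\<lambda>_. ennreal ((M * (t - s)) ^ n / fact n)) (flow s z)"
      proof (rule J_mono)
        fix w
        show "tail n (t - s) (fst (flow s z), w) \<le> ennreal ((M * (t - s)) ^ n / fact n)"
          using True sub by (intro Suc.IH Suc.prems(2)) (auto simp: flow_def)
      qed
      also have "\<dots> = ennreal (ratez (flow s z) * ((M * (t - s)) ^ n / fact n))"
        using True assms(2) by (subst ennreal_mult) (simp_all add: J_const)
      also have "\<dots> \<le> ennreal (M * ((M * (t - s)) ^ n / fact n))"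
        using True assms(2)
        by (intro ennreal_leI mult_right_mono Suc.prems) (auto simp: flow_def dist_norm)
      finally show ?thesis
        using True by simp
    qed simp
  qed
  also have "\<dots> = ennreal (- ((M * (t - t)) ^ Suc n / fact (Suc n)) - - ((M * (t - 0)) ^ Suc n / fact (Suc n)))"
  proof (rule nn_integral_FTC_Icc)
    show "((\<lambda>s. - ((M * (t - s)) ^ Suc n / fact (Suc n))) has_real_derivative M * ((M * (t - s)) ^ n / fact n)) (at s)" for s
      by (rule derivative_eq_intros refl | simp)+
    show "0 \<le> M * ((M * (t - s)) ^ n / fact n)" if "s \<in> {0..t}" for s
      using that assms(2) by simp
  qed (use Suc.prems in auto)
  finally show ?case by simp
qed

text \<open>The continuous total rate dominates each single rate, so one bound on the compact ball
  covers all velocities.\<close>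

lemma rate_bounded_on_cball:
  obtains M where "0 \<le> M" "\<And>y w. y \<in> cball x t \<Longrightarrow> rate G lr y w \<le> M"
proof -
  have "continuous_on (cball x t) (total_rate G lr)"
    unfolding total_rate_def
    by (intro continuous_intros continuous_on_subset[OF continuous_rate]) auto
  then have "bounded (total_rate G lr ` cball x t)"
    by (intro compact_imp_bounded compact_continuous_image) auto
  then obtain M where "\<forall>r\<in>total_rate G lr ` cball x t. \<bar>r\<bar> \<le> M"
    unfolding bounded_real by blast
  then have M: "\<bar>total_rate G lr y\<bar> \<le> M" if "y \<in> cball x t" for y
    using that by blast
  have "rate G lr y w \<le> max 0 M" if "y \<in> cball x t" for y w
  proof -
    have "rate G lr y w \<le> total_rate G lr y"
      unfolding total_rate_def by (rule member_le_sum) auto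
    with M[OF that] show ?thesis by linarith
  qed
  then show thesis by (intro that[of "max 0 M"]) auto
qed

text \<open>By telescoping \<open>K_plus_tail\<close>, the partial sums and the \<open>tail\<close>
  always add up to 1, and the factorial bound sends the \<open>tail\<close> to 0.\<close>

theorem suminf_K_1:
  assumes "0 \<le> t"
  shows "(\<Sum>n. K n t (\<lambda>_. 1) z) = 1"
proof -
  obtain M where M: "0 \<le> M" "\<And>y w. y \<in> cball (fst z) t \<Longrightarrow> rate G lr y w \<le> M"
    using rate_bounded_on_cball by blast
  have "(\<lambda>n. ennreal ((M * t) ^ n / fact n)) \<longlonglongrightarrow> ennreal 0"
    using summable_LIMSEQ_zero[OF summable_exp[of "M * t"]]
    by (intro tendsto_ennrealI) (simp add: field_simps)
  then have "(\<lambda>n. tail n t z) \<longlonglongrightarrow> 0"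
    by (intro tendsto_sandwich[OF _ _ tendsto_const, of 0 "\<lambda>n. tail n t z" sequentially "\<lambda>n. ennreal ((M * t) ^ n / fact n)"])
       (auto intro!: always_eventually tail_le assms M)
  moreover have "(\<lambda>n. \<Sum>i<n. K i t (\<lambda>_. 1) z) \<longlonglongrightarrow> (\<Sum>n. K n t (\<lambda>_. 1) z)"
    by (rule summable_LIMSEQ) simp
  ultimately have "(\<lambda>n. (\<Sum>i<n. K i t (\<lambda>_. 1) z) + tail n t z) \<longlonglongrightarrow> (\<Sum>n. K n t (\<lambda>_. 1) z) + 0"
    by (intro tendsto_add)
  moreover have "(\<Sum>i<n. K i t (\<lambda>_. 1) z) + tail n t z = 1" for n
  proof (induction n)
    case (Suc n)
    have "(\<Sum>i<Suc n. K i t (\<lambda>_. 1) z) + tail (Suc n) t z =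
      (\<Sum>i<n. K i t (\<lambda>_. 1) z) + (K n t (\<lambda>_. 1) z + tail (Suc n) t z)"
      by (simp add: add.assoc)
    then show ?case
      using Suc.IH K_plus_tail[OF assms, of n z] by (simp del: tail.simps)
  qed simp
  ultimately show ?thesis
    by (simp add: LIMSEQ_const_iff)
qed

end

subsection \<open>Time reversal\<close>

lemma measurable_flipz' [measurable (raw)]:
  assumes [measurable]: "g \<in> measurable M stateM"
  shows "(\<lambda>x. flipz (g x)) \<in> measurable M stateM"
  by (rule measurable_compose[OF assms measurable_flipz])

text \<open>Turning round at the end of a path and flying for time \<open>s\<close> leads back to
  the point of the path at time \<open>t - s\<close>.\<close>

lemma flow_flipz_flow: "flow s (flipz (flow t z)) = flipz (flow (t - s) z)"
  by (simp add: flow_def flipz_def vel_flipv scaleR_diff_left)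

lemma measurable_section_stateM:
  fixes F :: "'r::topological_space \<Rightarrow> (real^'d::finite) \<times> ('d \<times> bool) \<Rightarrow> ennreal"
  assumes "(\<lambda>(r, z). F r z) \<in> borel_measurable (borel \<Otimes>\<^sub>M stateM)"
  shows "(\<lambda>r. F r z) \<in> borel_measurable borel"
  using measurable_Pair1[OF assms, of z] by simp

text \<open>For each fixed velocity the flow is a translation, which preserves Lebesgue
  measure.\<close>

lemma nn_integral_stateM_flow:
  assumes [measurable]: "h \<in> borel_measurable stateM"
  shows "(\<integral>\<^sup>+ z. h (flow t z) \<partial>stateM) = (\<integral>\<^sup>+ z. h z \<partial>stateM)"
proof -
  have "(\<integral>\<^sup>+ x. h (flow t (x, w)) \<partial>lborel) = (\<integral>\<^sup>+ x. h (x, w) \<partial>lborel)" for w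
    using nn_integral_lborel_shift[of "\<lambda>x. h (x, w)" "t *\<^sub>R vel w"]
    by (simp add: flow_def add.commute)
  then show ?thesis
    by (simp add: nn_integral_stateM)
qed

lemma nn_integral_Icc_reflect:
  assumes [measurable]: "h \<in> borel_measurable borel"
  shows "(\<integral>\<^sup>+ s\<in>{0..t}. h (t - s) \<partial>lborel) = (\<integral>\<^sup>+ s\<in>{0..t::real}. h s \<partial>lborel)"
  by (subst (2) nn_integral_real_affine[where c="-1" and t=t])
     (auto intro!: nn_integral_cong simp: indicator_def)

text \<open>Both sides integrate \<open>H\<close> over the triangle \<open>s, r \<ge> 0\<close>,
  \<open>s + r \<le> t\<close>.\<close>

lemma nn_integral_triangle_swap:
  assumes [measurable]: "(\<lambda>(s, r). H s r) \<in> borel_measurable (borel \<Otimes>\<^sub>M borel)"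
  shows "(\<integral>\<^sup>+ s\<in>{0..t}. (\<integral>\<^sup>+ r\<in>{0..t - s}. H s r \<partial>lborel) \<partial>lborel) =
    (\<integral>\<^sup>+ r\<in>{0..t::real}. (\<integral>\<^sup>+ s\<in>{0..t - r}. H s r \<partial>lborel) \<partial>lborel)"
proof -
  define H' where "H' s r = (if 0 \<le> s \<and> 0 \<le> r \<and> s + r \<le> t then H s r else 0)" for s r
  have [measurable]: "(\<lambda>(s, r). H' s r) \<in> borel_measurable (borel \<Otimes>\<^sub>M borel)"
    unfolding H'_def by measurable
  have "(\<integral>\<^sup>+ s\<in>{0..t}. (\<integral>\<^sup>+ r\<in>{0..t - s}. H s r \<partial>lborel) \<partial>lborel) = (\<integral>\<^sup>+ s. (\<integral>\<^sup>+ r. H' s r \<partial>lborel) \<partial>lborel)"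
    by (subst nn_integral_multc[symmetric])
       (auto intro!: nn_integral_cong simp: H'_def indicator_def)
  also have "\<dots> = (\<integral>\<^sup>+ r. (\<integral>\<^sup>+ s. H' s r \<partial>lborel) \<partial>lborel)"
    by (rule lborel_pair.Fubini'[symmetric]) measurable
  also have "\<dots> = (\<integral>\<^sup>+ r\<in>{0..t}. (\<integral>\<^sup>+ s\<in>{0..t - r}. H s r \<partial>lborel) \<partial>lborel)"
    by (subst nn_integral_multc[symmetric])
       (auto intro!: nn_integral_cong simp: H'_def indicator_def)
  finally show ?thesis .
qed

section \<open>Interchange of kernels with time integrals\<close>

context coordinate_sampler
begin

lemma P0_nn_integral:
  fixes S :: "real set"
  assumes [measurable]: "(\<lambda>(r, z). F r z) \<in> borel_measurable (borel \<Otimes>\<^sub>M stateM)" "S \<in> sets borel"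
  shows "P0 s (\<lambda>z. \<integral>\<^sup>+ r\<in>S. F r z \<partial>lborel) z = (\<integral>\<^sup>+ r\<in>S. P0 s (F r) z \<partial>lborel)"
proof -
  note [measurable] = measurable_section_stateM[OF assms(1)]
  show ?thesis
    unfolding P0_def by (subst nn_integral_cmult[symmetric]) (auto simp: mult.assoc)
qed

lemma J_nn_integral:
  fixes S :: "real set"
  assumes [measurable]: "(\<lambda>(r, z). F r z) \<in> borel_measurable (borel \<Otimes>\<^sub>M stateM)" "S \<in> sets borel"
  shows "J (\<lambda>z. \<integral>\<^sup>+ r\<in>S. F r z \<partial>lborel) z = (\<integral>\<^sup>+ r\<in>S. J (F r) z \<partial>lborel)"
proof -
  note [measurable] = measurable_section_stateM[OF assms(1)]
  show ?thesis
    unfolding J_def sum_distrib_left sum_distrib_right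
    by (subst nn_integral_sum) (auto simp: nn_integral_cmult mult.assoc)
qed

text \<open>Decomposition at the last jump, whereas \<open>K\<close> is defined by the first one.\<close>
lemma K_last_jump:
  assumes [measurable]: "f \<in> borel_measurable stateM"
  shows "K (Suc n) t f z = (\<integral>\<^sup>+ r\<in>{0..t}. K n (t - r) (J (P0 r f)) z \<partial>lborel)"
proof (induction n arbitrary: t z)
  case 0
  have K0: "K 0 u f = P0 u f" for u
    by (rule ext) simp
  have "K (Suc 0) t f z = (\<integral>\<^sup>+ s\<in>{0..t}. P0 s (J (P0 (t - s) f)) z \<partial>lborel)"
    by (simp add: K0)
  also have "\<dots> = (\<integral>\<^sup>+ s\<in>{0..t}. P0 (t - s) (J (P0 (t - (t - s)) f)) z \<partial>lborel)"
    by (rule nn_integral_Icc_reflect[symmetric]) measurable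
  finally show ?case by simp
next
  case (Suc n)
  have "K (Suc (Suc n)) t f z = (\<integral>\<^sup>+ s\<in>{0..t}. P0 s (J (K (Suc n) (t - s) f)) z \<partial>lborel)"
    by simp
  also have "\<dots> = (\<integral>\<^sup>+ s\<in>{0..t}. (\<integral>\<^sup>+ r\<in>{0..t - s}. P0 s (J (K n (t - s - r) (J (P0 r f)))) z \<partial>lborel) \<partial>lborel)"
  proof (intro nn_integral_cong arg_cong2[where f="(*)"] refl)
    fix s
    have "K (Suc n) (t - s) f = (\<lambda>z. \<integral>\<^sup>+ r\<in>{0..t - s}. K n (t - s - r) (J (P0 r f)) z \<partial>lborel)"
      by (rule ext) (rule Suc.IH)
    moreover have "J (\<lambda>z. \<integral>\<^sup>+ r\<in>{0..t - s}. K n (t - s - r) (J (P0 r f)) z \<partial>lborel) =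
        (\<lambda>z. \<integral>\<^sup>+ r\<in>{0..t - s}. J (K n (t - s - r) (J (P0 r f))) z \<partial>lborel)"
      by (rule ext, rule J_nn_integral) measurable
    moreover have "P0 s (\<lambda>z. \<integral>\<^sup>+ r\<in>{0..t - s}. J (K n (t - s - r) (J (P0 r f))) z \<partial>lborel) z =
        (\<integral>\<^sup>+ r\<in>{0..t - s}. P0 s (J (K n (t - s - r) (J (P0 r f)))) z \<partial>lborel)"
      by (rule P0_nn_integral) measurable
    ultimately show "P0 s (J (K (Suc n) (t - s) f)) z =
      (\<integral>\<^sup>+ r\<in>{0..t - s}. P0 s (J (K n (t - s - r) (J (P0 r f)))) z \<partial>lborel)"
      by (simp only:)
  qed
  \<comment> \<open>The first waiting time \<open>s\<close> and the last one \<open>r\<close> range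
    over a triangle. With \<open>r\<close> outermost, the inner integral is a first-jump
    decomposition on the horizon \<open>t - r\<close>.\<close>
  also have "\<dots> = (\<integral>\<^sup>+ r\<in>{0..t}. (\<integral>\<^sup>+ s\<in>{0..t - r}. P0 s (J (K n (t - s - r) (J (P0 r f)))) z \<partial>lborel) \<partial>lborel)"
    by (rule nn_integral_triangle_swap) measurable
  also have "\<dots> = (\<integral>\<^sup>+ r\<in>{0..t}. K (Suc n) (t - r) (J (P0 r f)) z \<partial>lborel)"
    by (simp add: diff_right_commute diff_diff_eq add.commute)
  finally show ?case .
qed

end

section \<open>Adjoints with respect to the weight \<open>exp (- U)\<close>\<close>

locale coordinate_sampler_potential = coordinate_sampler G lr
  for G :: "(real^'d::finite) \<Rightarrow> (real^'d)" and lr :: real +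
  fixes U :: "(real^'d) \<Rightarrow> real"
  assumes U_grad: "(U has_derivative (\<lambda>h. G x \<bullet> h)) (at x)"
begin

text \<open>Lebesgue measure times counting measure, weighted but not normalised;
  \<open>nn_integral_rho\<close> supplies the constant.\<close>

definition wint :: "((real^'d) \<times> ('d \<times> bool) \<Rightarrow> ennreal) \<Rightarrow> ennreal" where
  "wint f = (\<integral>\<^sup>+ z. ennreal (exp (- U (fst z))) * f z \<partial>stateM)"

lemma U_measurable [measurable]: "U \<in> borel_measurable borel"
  by (intro borel_measurable_continuous_onI continuous_at_imp_continuous_on ballI has_derivative_continuous[OF U_grad])

text \<open>The constant \<open>lr\<close> cancels, and
  \<open>max 0 a - max 0 (- a) = a\<close>.\<close>

lemma rate_flip: "ratez z - ratez (flipz z) = G (fst z) \<bullet> vel (snd z)"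
  by (simp add: rate_def flipz_def vel_flipv inner_commute)

lemma U_flow_diff:
  assumes "0 \<le> t"
  shows "((\<lambda>s. G (fst (flow s z)) \<bullet> vel (snd z)) has_integral U (fst (flow t z)) - U (fst z)) {0..t}"
proof -
  have "((\<lambda>s. U (fst (flow s z))) has_vector_derivative G (fst (flow s z)) \<bullet> vel (snd z)) (at s within {0..t})" for s
  proof -
    have "((\<lambda>s. fst z + s *\<^sub>R vel (snd z)) has_derivative (\<lambda>h. h *\<^sub>R vel (snd z))) (at s within {0..t})"
      by (auto intro!: derivative_eq_intros)
    from has_derivative_compose[OF this U_grad] show ?thesis
      by (simp add: has_vector_derivative_def flow_def)
  qed
  from fundamental_theorem_of_calculus[OF assms this] show ?thesis
    by simp
qed

text \<open>By \<open>rate_flip\<close> the rates along the path and along its reversal differ by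
  the derivative of \<open>U\<close> in the direction of motion, which integrates to the increment
  of \<open>U\<close>. This increment is exactly the ratio of the two weights.\<close>

lemma survival_reversal:
  assumes "0 \<le> t"
  shows "exp (- U (fst z)) * survival G lr t z = exp (- U (fst (flow t z))) * survival G lr t (flipz (flow t z))"
proof -
  have int: "(\<lambda>s. ratez (flow s z)) integrable_on {0..t}"
    by (intro integrable_continuous_real continuous_rate_flow)
  have "(\<lambda>s. rate G lr (fst (flow s z)) (flipv (snd z))) integrable_on {0..t}"
  proof (rule integrable_continuous_real)
    show "continuous_on {0..t} (\<lambda>s. rate G lr (fst (flow s z)) (flipv (snd z)))"
      unfolding flow_def fst_conv by (intro continuous_on_compose2[OF continuous_rate] continuous_intros) auto
  qed
  then have int': "(\<lambda>s. ratez (flipz (flow s z))) integrable_on {0..t}"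
    by (simp add: flipz_def)
  have "integral {0..t} (\<lambda>s. ratez (flow s (flipz (flow t z)))) =
      enn2real (\<integral>\<^sup>+ s\<in>{0..t}. ennreal (ratez (flow s (flipz (flow t z)))) \<partial>lborel)"
    by (rule integral_rate_flow)
  also have "\<dots> = enn2real (\<integral>\<^sup>+ s\<in>{0..t}. ennreal (ratez (flipz (flow (t - s) z))) \<partial>lborel)"
    by (simp only: flow_flipz_flow)
  also have "\<dots> = enn2real (\<integral>\<^sup>+ s\<in>{0..t}. ennreal (ratez (flipz (flow s z))) \<partial>lborel)"
    by (subst nn_integral_Icc_reflect) auto
  also have "\<dots> = integral {0..t} (\<lambda>s. ratez (flipz (flow s z)))"
    using nn_integral_has_integral_lebesgue'[OF _ integrable_integral[OF int']]
    by (simp add: integral_nonneg[OF int'])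
  also have "\<dots> = integral {0..t} (\<lambda>s. ratez (flow s z)) - integral {0..t} (\<lambda>s. ratez (flow s z) - ratez (flipz (flow s z)))"
    by (subst Henstock_Kurzweil_Integration.integral_diff[OF int int']) simp
  also have "integral {0..t} (\<lambda>s. ratez (flow s z) - ratez (flipz (flow s z))) = U (fst (flow t z)) - U (fst z)"
  proof -
    have "ratez (flow s z) - ratez (flipz (flow s z)) = G (fst (flow s z)) \<bullet> vel (snd z)" for s
      using rate_flip[of "flow s z"] by simp
    then show ?thesis
      using integral_unique[OF U_flow_diff[OF assms, of z]] by (simp only:)
  qed
  finally have "integral {0..t} (\<lambda>s. ratez (flow s (flipz (flow t z)))) =
    integral {0..t} (\<lambda>s. ratez (flow s z)) - (U (fst (flow t z)) - U (fst z))" .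
  then show ?thesis
    unfolding survival_flow by (simp flip: exp_add del: snd_flow)
qed

text \<open>The substitution of \<open>flow t z\<close> for \<open>z\<close> preserves
  \<open>stateM\<close>; \<open>survival_reversal\<close> then carries the weight from the end of
  the flight to its start.\<close>

lemma wint_P0_adjoint:
  assumes [measurable]: "f \<in> borel_measurable stateM" "g \<in> borel_measurable stateM" and "0 \<le> t"
  shows "wint (\<lambda>z. g z * P0 t f z) = wint (\<lambda>z. f z * P0 t (\<lambda>z. g (flipz z)) (flipz z))"
proof -
  have "wint (\<lambda>z. f z * P0 t (\<lambda>z. g (flipz z)) (flipz z)) =
    (\<integral>\<^sup>+ z. ennreal (exp (- U (fst (flow t z)))) *
       (f (flow t z) * P0 t (\<lambda>z. g (flipz z)) (flipz (flow t z))) \<partial>stateM)"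
    unfolding wint_def
    by (rule nn_integral_stateM_flow[symmetric]) measurable
  also have "\<dots> = (\<integral>\<^sup>+ z. ennreal (exp (- U (fst (flow t z))) * survival G lr t (flipz (flow t z))) *
       (f (flow t z) * g z) \<partial>stateM)"
    by (simp add: P0_def flow_flipz_flow ennreal_mult mult_ac)
  also have "\<dots> = wint (\<lambda>z. g z * P0 t f z)"
    unfolding survival_reversal[OF \<open>0 \<le> t\<close>, symmetric] wint_def
    by (simp add: P0_def ennreal_mult mult_ac)
  finally show ?thesis ..
qed

text \<open>A jump keeps the position and the weight depends only on the position, so the claim is
  an identity of finite sums over velocities at each fixed \<open>x\<close>.\<close>

lemma wint_J_adjoint:
  assumes [measurable]: "f \<in> borel_measurable stateM" "g \<in> borel_measurable stateM"
  shows "wint (\<lambda>z. g z * J f z) = wint (\<lambda>z. f z * J (\<lambda>z. g (flipz z)) (flipz z))"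
proof -
  have "(\<Sum>w\<in>UNIV. g (x, w) * J f (x, w)) = (\<Sum>w\<in>UNIV. f (x, w) * J (\<lambda>z. g (flipz z)) (flipz (x, w)))" for x
  proof -
    let ?c = "\<lambda>w u. ennreal (rate G lr x w * rate G lr x (flipv u) / total_rate G lr x)"
    have "(\<Sum>w\<in>UNIV. g (x, w) * J f (x, w)) = (\<Sum>w\<in>UNIV. \<Sum>u\<in>UNIV. ?c w u * (g (x, w) * f (x, u)))"
      by (simp add: J_def jump_prob_def sum_distrib_left mult_ac ennreal_mult'[symmetric]
          flip: times_divide_eq_right)
    also have "\<dots> = (\<Sum>u\<in>UNIV. \<Sum>w\<in>UNIV. ?c w u * (g (x, w) * f (x, u)))"
      by (rule sum.swap)
    \<comment> \<open>After the flip of \<open>w\<close> the coefficient is symmetric in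
      \<open>flipv w\<close> and \<open>flipv u\<close>, hence it is also the intensity of the jump
      from \<open>flipv u\<close> to \<open>w\<close>.\<close>
    also have "\<dots> = (\<Sum>u\<in>UNIV. \<Sum>w\<in>UNIV. ?c (flipv w) u * (g (x, flipv w) * f (x, u)))"
      by (rule sum.cong[OF refl], rule sum_flipv[symmetric])
    also have "\<dots> = (\<Sum>u\<in>UNIV. f (x, u) * J (\<lambda>z. g (flipz z)) (flipz (x, u)))"
      by (simp add: J_def jump_prob_def flipz_def sum_distrib_left mult_ac ennreal_mult'[symmetric]
          flip: times_divide_eq_right)
    finally show ?thesis .
  qed
  then show ?thesis
    unfolding wint_def
    by (simp add: nn_integral_stateM nn_integral_sum[symmetric] sum_distrib_left[symmetric])
qed

lemma wint_nn_integral: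
  fixes a b :: real
  assumes [measurable]: "(\<lambda>(r, z). F r z) \<in> borel_measurable (borel \<Otimes>\<^sub>M stateM)" "g \<in> borel_measurable stateM"
  shows "wint (\<lambda>z. g z * (\<integral>\<^sup>+ r\<in>{a..b}. F r z \<partial>lborel)) = (\<integral>\<^sup>+ r\<in>{a..b}. wint (\<lambda>z. g z * F r z) \<partial>lborel)"
proof -
  have "wint (\<lambda>z. g z * (\<integral>\<^sup>+ r\<in>{a..b}. F r z \<partial>lborel)) =
    (\<integral>\<^sup>+ z. (\<integral>\<^sup>+ r. ennreal (exp (- U (fst z))) * (g z * F r z) * indicator {a..b} r \<partial>lborel) \<partial>stateM)"
  proof -
    note [measurable] = measurable_section_stateM[OF assms(1)]
    show ?thesis
      unfolding wint_def by (simp add: nn_integral_cmult mult.assoc)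
  qed
  also have "\<dots> = (\<integral>\<^sup>+ r. (\<integral>\<^sup>+ z. ennreal (exp (- U (fst z))) * (g z * F r z) * indicator {a..b} r \<partial>stateM) \<partial>lborel)"
    by (rule lborel_stateM.Fubini') measurable
  also have "\<dots> = (\<integral>\<^sup>+ r\<in>{a..b}. wint (\<lambda>z. g z * F r z) \<partial>lborel)"
    unfolding wint_def by (simp add: nn_integral_multc)
  finally show ?thesis .
qed

text \<open>Skew detailed balance: reversing time along a trajectory amounts to flipping its velocities.\<close>
lemma wint_K_adjoint:
  assumes "f \<in> borel_measurable stateM" "g \<in> borel_measurable stateM" "0 \<le> t"
  shows "wint (\<lambda>z. g z * K n t f z) = wint (\<lambda>z. f z * K n t (\<lambda>z. g (flipz z)) (flipz z))"
  using assms
proof (induction n arbitrary: t f g)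
  case 0
  then show ?case by (simp add: wint_P0_adjoint)
next
  case (Suc n)
  note [measurable] = Suc.prems(1,2)
  let ?g = "\<lambda>z. g (flipz z)"
  have "wint (\<lambda>z. g z * K (Suc n) t f z) = (\<integral>\<^sup>+ s\<in>{0..t}. wint (\<lambda>z. g z * P0 s (J (K n (t - s) f)) z) \<partial>lborel)"
    unfolding K.simps by (rule wint_nn_integral) measurable
  \<comment> \<open>Moving \<open>P0 s\<close>, \<open>J\<close> and \<open>K n (t - s)\<close> to
    the other factor one after another reverses their order, so the first flight becomes the
    last.\<close>
  also have "\<dots> = (\<integral>\<^sup>+ s\<in>{0..t}. wint (\<lambda>z. f z * K n (t - s) (J (P0 s ?g)) (flipz z)) \<partial>lborel)"
  proof (rule nn_integral_cong)
    fix s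
    have "wint (\<lambda>z. g z * P0 s (J (K n (t - s) f)) z) = wint (\<lambda>z. f z * K n (t - s) (J (P0 s ?g)) (flipz z))"
      if s: "0 \<le> s" "s \<le> t"
    proof -
      have "wint (\<lambda>z. g z * P0 s (J (K n (t - s) f)) z) =
          wint (\<lambda>z. J (K n (t - s) f) z * P0 s ?g (flipz z))"
        by (rule wint_P0_adjoint[OF _ _ s(1)]) measurable
      also have "\<dots> = wint (\<lambda>z. P0 s ?g (flipz z) * J (K n (t - s) f) z)"
        by (simp only: mult.commute)
      also have "\<dots> = wint (\<lambda>z. K n (t - s) f z * J (P0 s ?g) (flipz z))"
        by (subst wint_J_adjoint) simp_all
      also have "\<dots> = wint (\<lambda>z. J (P0 s ?g) (flipz z) * K n (t - s) f z)"
        by (simp only: mult.commute)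
      also have "\<dots> = wint (\<lambda>z. f z * K n (t - s) (J (P0 s ?g)) (flipz z))"
        using s by (subst Suc.IH) simp_all
      finally show ?thesis .
    qed
    then show "wint (\<lambda>z. g z * P0 s (J (K n (t - s) f)) z) * indicator {0..t} s =
        wint (\<lambda>z. f z * K n (t - s) (J (P0 s ?g)) (flipz z)) * indicator {0..t} s"
      by (simp add: indicator_def)
  qed
  also have "\<dots> = wint (\<lambda>z. f z * (\<integral>\<^sup>+ s\<in>{0..t}. K n (t - s) (J (P0 s ?g)) (flipz z) \<partial>lborel))"
    by (rule wint_nn_integral[symmetric]) measurable
  \<comment> \<open>The integrand now has its last jump singled out, so \<open>K_last_jump\<close>
    rather than the recursion of \<open>K\<close> recombines it.\<close>
  also have "\<dots> = wint (\<lambda>z. f z * K (Suc n) t ?g (flipz z))"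
    by (subst K_last_jump) simp_all
  finally show ?case .
qed

text \<open>With \<open>g = 1\<close> in \<open>wint_K_adjoint\<close> the kernels act on the
  constant 1, and by non-explosion their sum is 1 from the flipped state.\<close>

lemma wint_trans:
  assumes [measurable]: "A \<in> sets stateM" and t: "0 \<le> t"
  shows "wint (\<lambda>z. trans G lr t z A) = wint (indicator A)"
proof -
  have "wint (\<lambda>z. trans G lr t z A) = (\<Sum>n. wint (\<lambda>z. 1 * K n t (indicator A) z))"
    unfolding wint_def trans_eq
    by (simp add: nn_integral_suminf[symmetric])
  also have "\<dots> = (\<Sum>n. wint (\<lambda>z. indicator A z * K n t (\<lambda>_. 1) (flipz z)))"
    using t by (subst wint_K_adjoint) simp_all
  also have "\<dots> = wint (\<lambda>z. indicator A z * (\<Sum>n. K n t (\<lambda>_. 1) (flipz z)))"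
    unfolding wint_def by (simp add: nn_integral_suminf[symmetric])
  finally show ?thesis
    by (simp add: suminf_K_1[OF t])
qed

end

subsection \<open>Invariance\<close>

context coordinate_sampler_potential
begin

lemma normalisation_pos:
  assumes int: "integrable lborel (\<lambda>x. exp (- U x))"
  shows "0 < (\<integral>x. exp (- U x) \<partial>lborel)"
proof -
  have "(\<integral>x. exp (- U x) \<partial>lborel) \<noteq> 0"
  proof
    assume "(\<integral>x. exp (- U x) \<partial>lborel) = 0"
    then have "AE x in lborel. exp (- U x) = 0"
      using integral_nonneg_eq_0_iff_AE[OF int] by simp
    then have "AE x in (lborel :: (real^'d) measure). False" by simp
    then have "UNIV \<in> null_sets (lborel :: (real^'d) measure)"
      by (subst AE_iff_null_sets) auto
    then show False by auto
  qed
  moreover have "0 \<le> (\<integral>x. exp (- U x) \<partial>lborel)"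
    by (rule integral_nonneg_AE) simp
  ultimately show ?thesis by linarith
qed

lemma prob_space_target:
  assumes int: "integrable lborel (\<lambda>x. exp (- U x))"
  shows "prob_space (target U)"
proof
  let ?Z = "\<integral>x. exp (- U x) \<partial>lborel"
  have "emeasure (target U) (space (target U)) = (\<integral>\<^sup>+ x. ennreal (exp (- U x) / ?Z) \<partial>lborel)"
    by (simp add: target_def emeasure_density)
  also have "\<dots> = ennreal (\<integral>x. exp (- U x) / ?Z \<partial>lborel)"
    using int normalisation_pos[OF int] by (intro nn_integral_eq_integral) auto
  also have "(\<integral>x. exp (- U x) / ?Z \<partial>lborel) = 1"
    using normalisation_pos[OF int] by simp
  finally show "emeasure (target U) (space (target U)) = 1" by simp
qed

lemma sets_target [measurable_cong, simp]: "sets (target U) = sets borel"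
  by (simp add: target_def)

lemma sets_rho: "sets (rho U) = sets stateM"
  unfolding rho_def stateM_def
  by (intro sets_pair_measure_cong) (auto simp: sets_uniform_count_measure)

text \<open>A constant factor separates \<open>rho U\<close> from \<open>wint\<close>. It occurs on
  both sides of the invariance equation, so the unnormalised \<open>wint_trans\<close>
  suffices.\<close>

lemma
  assumes int: "integrable lborel (\<lambda>x. exp (- U x))"
  shows prob_space_rho: "prob_space (rho U)"
    and nn_integral_rho: "f \<in> borel_measurable stateM \<Longrightarrow>
      (\<integral>\<^sup>+ z. f z \<partial>rho U) = ennreal (1 / (CARD('d \<times> bool) * (\<integral>x. exp (- U x) \<partial>lborel))) * wint f"
proof -
  let ?Z = "\<integral>x. exp (- U x) \<partial>lborel"
  let ?u = "uniform_count_measure (UNIV :: ('d \<times> bool) set)"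
  interpret T: prob_space "target U" by (rule prob_space_target[OF int])
  interpret C: prob_space ?u
    by (rule prob_space_uniform_count_measure) auto
  interpret pair_prob_space "target U" ?u ..
  show "prob_space (rho U)"
    unfolding rho_def by unfold_locales
  assume f: "f \<in> borel_measurable stateM"
  note [measurable] = f
  have "f \<in> borel_measurable (target U \<Otimes>\<^sub>M ?u)"
    using f sets_rho by (simp add: rho_def cong: measurable_cong_sets)
  then have "(\<integral>\<^sup>+ z. f z \<partial>rho U) = (\<integral>\<^sup>+ w. \<integral>\<^sup>+ x. f (x, w) \<partial>target U \<partial>?u)"
    unfolding rho_def by (subst nn_integral_snd) simp_all
  also have "\<dots> = (\<Sum>w\<in>UNIV. ennreal (1 / CARD('d \<times> bool)) * (\<integral>\<^sup>+ x. f (x, w) \<partial>target U))"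
    unfolding uniform_count_measure_def
    by (subst nn_integral_point_measure_finite) (auto simp: mult.commute)
  also have "\<dots> = (\<Sum>w\<in>UNIV. ennreal (1 / CARD('d \<times> bool)) * (ennreal (1 / ?Z) * (\<integral>\<^sup>+ x. ennreal (exp (- U x)) * f (x, w) \<partial>lborel)))"
  proof (intro sum.cong refl arg_cong2[where f="(*)"])
    fix w :: "'d \<times> bool"
    have "(\<integral>\<^sup>+ x. f (x, w) \<partial>target U) = (\<integral>\<^sup>+ x. ennreal (exp (- U x) / ?Z) * f (x, w) \<partial>lborel)"
      unfolding target_def by (rule nn_integral_density) auto
    also have "\<dots> = (\<integral>\<^sup>+ x. ennreal (1 / ?Z) * (ennreal (exp (- U x)) * f (x, w)) \<partial>lborel)"
      using normalisation_pos[OF int]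
      by (intro nn_integral_cong) (simp add: mult.assoc[symmetric] ennreal_mult[symmetric])
    also have "\<dots> = ennreal (1 / ?Z) * (\<integral>\<^sup>+ x. ennreal (exp (- U x)) * f (x, w) \<partial>lborel)"
      by (rule nn_integral_cmult) measurable
    finally show "(\<integral>\<^sup>+ x. f (x, w) \<partial>target U) = ennreal (1 / ?Z) * (\<integral>\<^sup>+ x. ennreal (exp (- U x)) * f (x, w) \<partial>lborel)" .
  qed
  also have "\<dots> = ennreal (1 / (CARD('d \<times> bool) * ?Z)) * wint f"
    using normalisation_pos[OF int]
    unfolding wint_def
    by (simp add: nn_integral_stateM sum_distrib_left mult.assoc[symmetric] ennreal_mult[symmetric])
  finally show "(\<integral>\<^sup>+ z. f z \<partial>rho U) = ennreal (1 / (CARD('d \<times> bool) * ?Z)) * wint f" .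
qed

theorem invariant_rho:
  assumes int: "integrable lborel (\<lambda>x. exp (- U x))"
  shows "invariant G lr (rho U)"
  unfolding invariant_def
proof (intro conjI allI impI ballI)
  show "prob_space (rho U)" by (rule prob_space_rho[OF int])
  show "sets (rho U) = sets stateM" by (rule sets_rho)
  fix t :: real and A :: "((real^'d) \<times> ('d \<times> bool)) set"
  assume t: "0 \<le> t" and [measurable]: "A \<in> sets stateM"
  have "(\<integral>\<^sup>+ z. trans G lr t z A \<partial>rho U) = (\<integral>\<^sup>+ z. indicator A z \<partial>rho U)"
    using wint_trans[OF _ t, of A]
    by (subst (1 2) nn_integral_rho[OF int]) (auto simp: trans_eq)
  also have "\<dots> = emeasure (rho U) A"
    by (simp add: sets_rho)
  finally show "(\<integral>\<^sup>+ z. trans G lr t z A \<partial>rho U) = emeasure (rho U) A" .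
qed

end

subsection \<open>Uniqueness of invariant laws of irreducible kernels\<close>

text \<open>Two inequalities whose sums agree must be equalities once the finite \<open>d\<close>
  can be cancelled. This serves to compare masses on a set and on its complement.\<close>

lemma ennreal_add_eq_imp_eq:
  fixes a b c d :: ennreal
  assumes "a \<le> b" "c \<le> d" "a + c = b + d" "d \<noteq> \<top>"
  shows "a = b"
proof -
  have "d + b = c + a" using assms(3) by (simp add: add.commute)
  also have "\<dots> \<le> d + a" using assms(2) by (rule add_right_mono)
  finally have "b \<le> a"
    using assms(4) by (simp add: ennreal_add_left_cancel_le)
  with assms(1) show ?thesis by simp
qed

text \<open>Restricted to \<open>Y\<close> by the density \<open>indicator Y\<close>, the two are
  ordered as measures, and the integral is monotone in the measure.\<close>

lemma nn_integral_mono_measure_on: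
  assumes sets: "sets N = sets M" and Y [measurable]: "Y \<in> sets M"
    and le: "\<And>X. X \<in> sets M \<Longrightarrow> X \<subseteq> Y \<Longrightarrow> emeasure N X \<le> emeasure M X"
    and f [measurable]: "f \<in> borel_measurable M"
  shows "(\<integral>\<^sup>+ z\<in>Y. f z \<partial>N) \<le> (\<integral>\<^sup>+ z\<in>Y. f z \<partial>M)"
proof -
  have YN [measurable]: "Y \<in> sets N" and fN [measurable]: "f \<in> borel_measurable N"
    using Y f sets by (auto cong: measurable_cong_sets)
  have "density N (indicator Y) \<le> density M (indicator Y)"
    using le sets by (subst le_measure) (auto simp: le_fun_def emeasure_restricted)
  then have "integral\<^sup>N (density N (indicator Y)) f \<le> integral\<^sup>N (density M (indicator Y)) f"
    using sets by (intro nn_integral_mono_measure) auto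
  then show ?thesis
    by (simp add: nn_integral_density mult.commute)
qed

text \<open>For an invariant law the mass flowing from \<open>Y\<close> to its complement equals the mass flowing back.
  If \<open>Y\<close> is the positive Hahn set of \<open>M - N\<close>, then more mass leaves \<open>Y\<close> under \<open>M\<close> than under \<open>N\<close>,
  while less flows back.\<close>
lemma invariant_eq_if_escape:
  fixes R :: "'a \<Rightarrow> 'a set \<Rightarrow> ennreal"
  assumes M: "prob_space M" and N: "prob_space N" and sets: "sets N = sets M"
    and R [measurable]: "\<And>A. A \<in> sets M \<Longrightarrow> (\<lambda>z. R z A) \<in> borel_measurable M"
    and R_compl: "\<And>z A. z \<in> space M \<Longrightarrow> A \<in> sets M \<Longrightarrow> R z A + R z (space M - A) = 1"
    and inv_M: "\<And>A. A \<in> sets M \<Longrightarrow> (\<integral>\<^sup>+ z. R z A \<partial>M) = emeasure M A"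
    and inv_N: "\<And>A. A \<in> sets M \<Longrightarrow> (\<integral>\<^sup>+ z. R z A \<partial>N) = emeasure N A"
    and Y [measurable]: "Y \<in> sets M"
    and pos: "\<And>X. X \<in> sets M \<Longrightarrow> X \<subseteq> Y \<Longrightarrow> emeasure N X \<le> emeasure M X"
    and neg: "\<And>X. X \<in> sets M \<Longrightarrow> X \<inter> Y = {} \<Longrightarrow> emeasure M X \<le> emeasure N X"
    and escape: "\<And>z. z \<in> space M \<Longrightarrow> R z (space M - Y) > 0"
  shows "M = N"
proof -
  interpret M: prob_space M by fact
  interpret N: prob_space N by fact
  define Y' where "Y' = space M - Y"
  have [measurable]: "Y' \<in> sets M" by (simp add: Y'_def)
  have space: "space N = space M" using sets by (rule sets_eq_imp_space_eq)
  have meas_N [simp]: "borel_measurable N = (borel_measurable M :: ('a \<Rightarrow> ennreal) set)"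
    using sets by (rule measurable_cong_sets) simp
  note [simp] = sets
  have flow_balance: "(\<integral>\<^sup>+ z\<in>Y. R z Y' \<partial>P) = (\<integral>\<^sup>+ z\<in>Y'. R z Y \<partial>P)"
    if P: "prob_space P" and sP [measurable_cong]: "sets P = sets M"
      and iP: "(\<integral>\<^sup>+ z. R z Y' \<partial>P) = emeasure P Y'" for P
  proof -
    interpret P: prob_space P by fact
    have spP: "space P = space M" using sP by (rule sets_eq_imp_space_eq)
    have [measurable]: "(\<lambda>z. R z Y) \<in> borel_measurable P" "(\<lambda>z. R z Y') \<in> borel_measurable P"
      using R[of Y] R[of Y'] sP by (auto cong: measurable_cong_sets)
    \<comment> \<open>The mass in \<open>Y'\<close> after one step is computed twice: split by the
      starting set and, by stationarity, as the initial mass of \<open>Y'\<close>, which either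
      stays or moves to \<open>Y\<close>.\<close>
    have "(\<integral>\<^sup>+ z\<in>Y'. R z Y' \<partial>P) + (\<integral>\<^sup>+ z\<in>Y. R z Y' \<partial>P) = (\<integral>\<^sup>+ z. R z Y' \<partial>P)"
      by (subst nn_integral_add[symmetric])
         (auto intro!: nn_integral_cong simp: spP Y'_def indicator_def)
    also have "\<dots> = (\<integral>\<^sup>+ z. indicator Y' z \<partial>P)"
      unfolding iP by (simp add: sP)
    also have "\<dots> = (\<integral>\<^sup>+ z. R z Y' * indicator Y' z + R z Y * indicator Y' z \<partial>P)"
      using R_compl[of _ Y]
      by (intro nn_integral_cong) (auto simp: spP indicator_def Y'_def add.commute)
    also have "\<dots> = (\<integral>\<^sup>+ z\<in>Y'. R z Y' \<partial>P) + (\<integral>\<^sup>+ z\<in>Y'. R z Y \<partial>P)"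
      by (rule nn_integral_add) measurable
    finally have eq: "(\<integral>\<^sup>+ z\<in>Y'. R z Y' \<partial>P) + (\<integral>\<^sup>+ z\<in>Y. R z Y' \<partial>P) =
      (\<integral>\<^sup>+ z\<in>Y'. R z Y' \<partial>P) + (\<integral>\<^sup>+ z\<in>Y'. R z Y \<partial>P)" .
    have "(\<integral>\<^sup>+ z\<in>Y'. R z Y' \<partial>P) \<le> (\<integral>\<^sup>+ z. R z Y' \<partial>P)"
      by (intro nn_integral_mono) (simp add: indicator_def)
    then have "(\<integral>\<^sup>+ z\<in>Y'. R z Y' \<partial>P) \<noteq> \<top>"
      unfolding iP by (metis P.emeasure_finite infinity_ennreal_def neq_top_trans)
    with eq show ?thesis
      by (simp add: ennreal_add_left_cancel)
  qed
  \<comment> \<open>\<open>h\<close> is the density of the mass leaving \<open>Y\<close>.\<close>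
  define h where "h = (\<lambda>z. R z Y' * indicator Y z)"
  have h [measurable]: "h \<in> borel_measurable M"
    unfolding h_def by measurable
  have "integral\<^sup>N N h \<le> integral\<^sup>N M h"
    unfolding h_def using pos by (intro nn_integral_mono_measure_on) auto
  moreover have "integral\<^sup>N M h \<le> integral\<^sup>N N h"
  \<comment> \<open>Outflow is turned into inflow, compared on \<open>Y'\<close> where
    \<open>N\<close> dominates \<open>M\<close>, and turned back into outflow.\<close>
  proof -
    have "integral\<^sup>N M h = (\<integral>\<^sup>+ z\<in>Y'. R z Y \<partial>M)"
      unfolding h_def by (intro flow_balance inv_M M) auto
    also have "\<dots> \<le> (\<integral>\<^sup>+ z\<in>Y'. R z Y \<partial>N)"
      using neg by (intro nn_integral_mono_measure_on) (auto simp: Y'_def)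
    also have "\<dots> = integral\<^sup>N N h"
      unfolding h_def by (intro flow_balance[symmetric] inv_N N) auto
    finally show ?thesis .
  qed
  ultimately have h_eq: "integral\<^sup>N N h = integral\<^sup>N M h" by simp
  have R_le: "R z A \<le> 1" if "z \<in> space M" "A \<in> sets M" for z A
    using R_compl[OF that] by (metis le_iff_add)
  have h_le: "integral\<^sup>N M h \<le> 1"
  proof -
    have "integral\<^sup>N M h \<le> (\<integral>\<^sup>+ z. 1 \<partial>M)"
      unfolding h_def using R_le[of _ Y'] by (intro nn_integral_mono) (auto simp: indicator_def)
    then show ?thesis by (simp add: M.emeasure_space_1)
  qed
  \<comment> \<open>\<open>h\<close> lives on \<open>Y\<close>, where \<open>N\<close> lies below
    \<open>M\<close>. Equal finite totals leave no room for strict inequality on any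
    \<open>X\<close>.\<close>
  have "density N h = density M h"
  proof (rule measure_eqI)
    fix X assume "X \<in> sets (density N h)"
    then have [measurable]: "X \<in> sets M" by simp
    have le: "(\<integral>\<^sup>+ z\<in>X. h z \<partial>N) \<le> (\<integral>\<^sup>+ z\<in>X. h z \<partial>M)" if [measurable]: "X \<in> sets M" for X
    proof -
      have "(\<integral>\<^sup>+ z\<in>Y. (h z * indicator X z) \<partial>N) \<le> (\<integral>\<^sup>+ z\<in>Y. (h z * indicator X z) \<partial>M)"
        using pos by (intro nn_integral_mono_measure_on) auto
      moreover have "h z * indicator X z * indicator Y z = h z * indicator X z" for z
        by (simp add: h_def indicator_def)
      ultimately show ?thesis by simp
    qed
    have split: "(\<integral>\<^sup>+ z\<in>X. h z \<partial>P) + (\<integral>\<^sup>+ z\<in>space M - X. h z \<partial>P) = integral\<^sup>N P h"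
      if sP [measurable_cong]: "sets P = sets M" for P
    proof -
      have "space P = space M" using sP by (rule sets_eq_imp_space_eq)
      moreover have [measurable]: "h \<in> borel_measurable P"
        using h sP by (auto cong: measurable_cong_sets)
      ultimately show ?thesis
        by (subst nn_integral_add[symmetric]) (auto intro!: nn_integral_cong simp: indicator_def)
    qed
    have "(\<integral>\<^sup>+ z\<in>space M - X. h z \<partial>M) \<le> integral\<^sup>N M h"
      by (intro nn_integral_mono) (simp add: indicator_def)
    with h_le have "(\<integral>\<^sup>+ z\<in>space M - X. h z \<partial>M) \<noteq> \<top>"
      by (metis ennreal_one_neq_top neq_top_trans)
    then have "(\<integral>\<^sup>+ z\<in>X. h z \<partial>N) = (\<integral>\<^sup>+ z\<in>X. h z \<partial>M)"
      using le[of X] le[of "space M - X"] split[of M] split[of N] h_eq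
      by - (rule ennreal_add_eq_imp_eq[where c="\<integral>\<^sup>+ z\<in>space M - X. h z \<partial>N" and d="\<integral>\<^sup>+ z\<in>space M - X. h z \<partial>M"], simp_all)
    then show "emeasure (density N h) X = emeasure (density M h) X"
      by (simp add: emeasure_density)
  qed simp
  \<comment> \<open>Dividing \<open>h\<close> by the escape probability, which is positive and at
    most 1, recovers the mass of \<open>Y\<close>.\<close>
  moreover have "emeasure P Y = (\<integral>\<^sup>+ z. inverse (R z Y') \<partial>density P h)" if sP: "sets P = sets M" for P
  proof -
    have spP: "space P = space M" using sP by (rule sets_eq_imp_space_eq)
    have [measurable]: "h \<in> borel_measurable P" "(\<lambda>z. R z Y') \<in> borel_measurable P"
      using h R[of Y'] sP by (auto cong: measurable_cong_sets)
    have "(\<integral>\<^sup>+ z. inverse (R z Y') \<partial>density P h) = (\<integral>\<^sup>+ z. h z * inverse (R z Y') \<partial>P)"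
      by (rule nn_integral_density) auto
    also have "\<dots> = (\<integral>\<^sup>+ z. indicator Y z \<partial>P)"
    proof (rule nn_integral_cong)
      fix z assume "z \<in> space P"
      then have z: "z \<in> space M" by (simp add: spP)
      have "R z Y' \<noteq> \<top>" using R_le[OF z, of Y'] by (auto simp: top_unique)
      moreover have "R z Y' \<noteq> 0" using escape[OF z] by (simp add: Y'_def)
      ultimately have "R z Y' * inverse (R z Y') = 1"
        by (metis ennreal_divide_self divide_ennreal_def less_top)
      then show "h z * inverse (R z Y') = indicator Y z"
        by (simp add: h_def indicator_def)
    qed
    finally show ?thesis using sP by simp
  qed
  ultimately have Y_eq: "emeasure M Y = emeasure N Y"
    using sets by simp
  have Y'_eq: "emeasure M Y' = emeasure N Y'"
    using Y_eq emeasure_compl[of Y M] emeasure_compl[of Y N] space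
    by (simp add: Y'_def M.emeasure_space_1 N.emeasure_space_1[unfolded space])
  show "M = N"
  proof (rule measure_eqI)
    fix X assume [measurable]: "X \<in> sets M"
    have split: "emeasure P (X \<inter> W) + emeasure P (W - X) = emeasure P W"
      if "W \<in> sets M" "sets P = sets M" for W P
      using that by (subst plus_emeasure) (auto intro!: arg_cong[where f="emeasure P"])
    \<comment> \<open>The same squeeze: \<open>N\<close> is below \<open>M\<close> on both
      \<open>X \<inter> Y\<close> and \<open>Y - X\<close>, while the totals on \<open>Y\<close>
      agree.\<close>
    have "emeasure N (X \<inter> Y) = emeasure M (X \<inter> Y)"
      using split[of Y M] split[of Y N] Y_eq pos[of "X \<inter> Y"] pos[of "Y - X"]
      by - (rule ennreal_add_eq_imp_eq[where c="emeasure N (Y - X)" and d="emeasure M (Y - X)"], auto)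
    moreover have "emeasure M (X \<inter> Y') = emeasure N (X \<inter> Y')"
      using split[of Y' M] split[of Y' N] Y'_eq neg[of "X \<inter> Y'"] neg[of "Y' - X"]
      by - (rule ennreal_add_eq_imp_eq[where c="emeasure M (Y' - X)" and d="emeasure N (Y' - X)"], auto simp: Y'_def)
    moreover have "emeasure P X = emeasure P (X \<inter> Y) + emeasure P (X \<inter> Y')"
      if sP: "sets P = sets M" for P
    proof -
      have "X \<subseteq> space M" using \<open>X \<in> sets M\<close> by (rule sets.sets_into_space)
      then show ?thesis
        using sP by (subst plus_emeasure) (auto simp: Y'_def intro!: arg_cong[where f="emeasure P"])
    qed
    ultimately show "emeasure M X = emeasure N X"
      using sets by simp
  qed simp
qed

text \<open>The Hahn set \<open>Y\<close> is either left with positive probability from every state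
  or, by irreducibility, entered from every state. The second case is the first with the two laws
  exchanged and \<open>Y\<close> replaced by its complement.\<close>

lemma invariant_unique_if_irreducible:
  fixes R :: "'a \<Rightarrow> 'a set \<Rightarrow> ennreal"
  assumes M: "prob_space M" and N: "prob_space N" and sets: "sets N = sets M"
    and R: "\<And>A. A \<in> sets M \<Longrightarrow> (\<lambda>z. R z A) \<in> borel_measurable M"
    and R_compl: "\<And>z A. z \<in> space M \<Longrightarrow> A \<in> sets M \<Longrightarrow> R z A + R z (space M - A) = 1"
    and inv_M: "\<And>A. A \<in> sets M \<Longrightarrow> (\<integral>\<^sup>+ z. R z A \<partial>M) = emeasure M A"
    and inv_N: "\<And>A. A \<in> sets M \<Longrightarrow> (\<integral>\<^sup>+ z. R z A \<partial>N) = emeasure N A"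
    and irreducible: "\<And>A. A \<in> sets M \<Longrightarrow>
      (\<forall>z\<in>space M. R z A > 0) \<or> (\<forall>z\<in>space M. R z (space M - A) > 0)"
  shows "M = N"
proof -
  interpret M: prob_space M by fact
  interpret N: prob_space N by fact
  have space: "space N = space M" using sets by (rule sets_eq_imp_space_eq)
  from finite_unsigned_Hahn_decomposition[OF M.finite_measure_axioms N.finite_measure_axioms sets]
  obtain Y where Y: "Y \<in> sets M"
    and pos: "\<forall>X\<in>sets M. X \<subseteq> Y \<longrightarrow> emeasure N X \<le> emeasure M X"
    and neg: "\<forall>X\<in>sets M. X \<inter> Y = {} \<longrightarrow> emeasure M X \<le> emeasure N X"
    by (elim bexE conjE)
  show "M = N"
  proof (cases "\<forall>z\<in>space M. R z (space M - Y) > 0")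
    case True
    show ?thesis
      by (rule invariant_eq_if_escape[OF M N sets R R_compl inv_M inv_N Y])
         (use True pos neg in auto)
  next
    case False
    then have esc: "R z Y > 0" if "z \<in> space M" for z
      using irreducible[OF Y] that by blast
    have Y2: "space M - (space M - Y) = Y"
      using sets.sets_into_space[OF Y] by auto
    have "N = M"
    proof (rule invariant_eq_if_escape[where R=R and Y="space M - Y"])
      show "emeasure M X \<le> emeasure N X" if "X \<in> sets N" "X \<subseteq> space M - Y" for X
        using that sets neg by auto
      show "emeasure N X \<le> emeasure M X" if "X \<in> sets N" "X \<inter> (space M - Y) = {}" for X
      proof -
        have "X \<subseteq> Y" using that(2) sets.sets_into_space[OF that(1)] space by auto
        then show ?thesis using that(1) sets pos by auto
      qed
      show "(\<lambda>z. R z A) \<in> borel_measurable N" if "A \<in> sets N" for A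
        using R[of A] that sets by (auto cong: measurable_cong_sets)
    qed (use M N sets R_compl inv_M inv_N Y esc space Y2 in simp_all)
    then show ?thesis ..
  qed
qed

subsection \<open>Irreducibility\<close>

lemma AE_lborel_shift:
  assumes "AE x in lborel. P x"
  shows "AE x in lborel. P (c + x :: 'a::euclidean_space)"
proof -
  have "AE x in distr lborel borel ((+) c). P x"
    using assms unfolding lborel_distr_plus .
  then show ?thesis
    by (rule AE_distrD[rotated]) simp
qed

lemma AE_lborel_uminus:
  assumes "AE x in lborel. P x"
  shows "AE x in lborel. P (- x :: real)"
proof -
  have "AE x in distr lborel borel (uminus). P x"
    using assms unfolding lborel_distr_uminus .
  then show ?thesis
    by (rule AE_distrD[rotated]) simp
qed

lemma AE_lborel_ex_nonneg:
  assumes "AE t in lborel. 0 \<le> t \<longrightarrow> P (t::real)"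
  shows "\<exists>t\<ge>0. P t"
proof (rule ccontr)
  assume "\<not> (\<exists>t\<ge>0. P t)"
  with assms have "AE t in lborel. t \<notin> {0..1::real}"
    by (elim eventually_mono) auto
  then have "{0..1} \<in> null_sets (lborel :: real measure)"
    by (subst AE_iff_null_sets) auto
  then show False by (simp add: null_sets_def)
qed

text \<open>Tonelli: a measurable set almost all of whose sections are null is null.\<close>

lemma AE_PiM_insert:
  fixes P :: "('i \<Rightarrow> real) \<Rightarrow> bool"
  assumes I: "finite I" "i \<notin> I"
    and P [measurable]: "Measurable.pred (PiM (insert i I) (\<lambda>_. lborel)) P"
    and AE: "AE y in lborel. AE x in PiM I (\<lambda>_. lborel). P (x(i := y))"
  shows "AE x in PiM (insert i I) (\<lambda>_. lborel). P x"
proof -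
  interpret product_sigma_finite "\<lambda>_ :: 'i. lborel :: real measure" ..
  interpret fI: finite_product_sigma_finite "\<lambda>_ :: 'i. lborel :: real measure" I
    by standard (rule I)
  have upd [measurable]: "(\<lambda>x. x(i := y)) \<in> measurable (PiM I (\<lambda>_. lborel)) (PiM (insert i I) (\<lambda>_. lborel))" for y :: real
    by (rule measurable_fun_upd[where J=I]) auto
  have ind: "(\<lambda>x. indicator {x. \<not> P x} x :: ennreal) \<in> borel_measurable (PiM (insert i I) (\<lambda>_. lborel))"
    unfolding indicator_def mem_Collect_eq by measurable
  have "(\<integral>\<^sup>+ x. indicator {x. \<not> P x} x \<partial>PiM (insert i I) (\<lambda>_. lborel)) =
      (\<integral>\<^sup>+ y. (\<integral>\<^sup>+ x. indicator {x. \<not> P x} (x(i := y)) \<partial>PiM I (\<lambda>_. lborel)) \<partial>lborel)"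
    by (rule product_nn_integral_insert_rev[OF I ind])
  also have "\<dots> = (\<integral>\<^sup>+ y. 0 \<partial>(lborel :: real measure))"
  proof (rule nn_integral_cong_AE, use AE in eventually_elim)
    case (elim y)
    then have "AE x in PiM I (\<lambda>_. lborel). indicator {x. \<not> P x} (x(i := y)) = (0 :: ennreal)"
      by eventually_elim simp
    from nn_integral_cong_AE[OF this] show ?case by simp
  qed
  finally have "(\<integral>\<^sup>+ x. indicator {x. \<not> P x} x \<partial>PiM (insert i I) (\<lambda>_. lborel)) = 0"
    by simp
  then have "AE x in PiM (insert i I) (\<lambda>_. lborel). indicator {x. \<not> P x} x = (0::ennreal)"
    using nn_integral_0_iff_AE[OF ind] by simp
  then show ?thesis
    by (elim eventually_mono) (simp add: indicator_def split: if_splits)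
qed

section \<open>Occupation times, unreachable positions and the resolvent\<close>

context coordinate_sampler
begin

lemma K_add:
  assumes [measurable]: "f \<in> borel_measurable stateM" "g \<in> borel_measurable stateM"
  shows "K n t (\<lambda>z. f z + g z) z = K n t f z + K n t g z"
proof (induction n arbitrary: t z)
  case 0
  show ?case by (simp add: P0_add)
next
  case (Suc n)
  have "J (K n u (\<lambda>z. f z + g z)) = (\<lambda>z. J (K n u f) z + J (K n u g) z)" for u
    by (rule ext, subst J_add[symmetric], rule J_cong) (rule Suc.IH)
  then have "K (Suc n) t (\<lambda>z. f z + g z) z =
      (\<integral>\<^sup>+ s. P0 s (J (K n (t - s) f)) z * indicator {0..t} s + P0 s (J (K n (t - s) g)) z * indicator {0..t} s \<partial>lborel)"
    by (simp add: P0_add distrib_right)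
  also have "\<dots> = K (Suc n) t f z + K (Suc n) t g z"
    unfolding K.simps by (rule nn_integral_add) measurable
  finally show ?case .
qed

lemma trans_compl:
  assumes [measurable]: "A \<in> sets stateM" and t: "0 \<le> t"
  shows "trans G lr t z A + trans G lr t z (UNIV - A) = 1"
proof -
  have [measurable]: "UNIV - A \<in> sets stateM"
    using sets.compl_sets[OF assms(1)] by simp
  have "trans G lr t z A + trans G lr t z (UNIV - A) =
      (\<Sum>n. K n t (\<lambda>z. indicator A z + indicator (UNIV - A) z) z)"
    unfolding trans_eq by (subst suminf_add) (simp_all add: K_add)
  also have "(\<lambda>z. indicator A z + indicator (UNIV - A) z :: ennreal) = (\<lambda>_. 1)"
    by (auto simp: indicator_def fun_eq_iff)
  finally show ?thesis by (simp add: suminf_K_1[OF t])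
qed

lemma measurable_trans [measurable (raw)]:
  assumes [measurable]: "A \<in> sets stateM" "f \<in> borel_measurable M" "g \<in> measurable M stateM"
  shows "(\<lambda>x. trans G lr (f x) (g x) A) \<in> borel_measurable M"
  unfolding trans_eq by measurable

text \<open>Expected occupation integral of \<open>f\<close> over the period between the
  \<open>n\<close>-th and the next event. Integration over all times turns the convolution recursion
  of \<open>K\<close> into plain iteration.\<close>

definition occ :: "nat \<Rightarrow> ((real^'d) \<times> ('d \<times> bool) \<Rightarrow> ennreal) \<Rightarrow> (real^'d) \<times> ('d \<times> bool) \<Rightarrow> ennreal" where
  "occ n f z = (\<integral>\<^sup>+ t\<in>{0..}. K n t f z \<partial>lborel)"

lemma measurable_occ [measurable (raw)]:
  assumes [measurable]: "f \<in> borel_measurable stateM" "g \<in> measurable M stateM"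
  shows "(\<lambda>x. occ n f (g x)) \<in> borel_measurable M"
  unfolding occ_def by measurable

text \<open>After Fubini, the substitution \<open>t = s + u\<close> separates the first flight time
  \<open>s\<close> from the remaining time \<open>u\<close>.\<close>

lemma occ_Suc:
  assumes [measurable]: "f \<in> borel_measurable stateM"
  shows "occ (Suc n) f z = (\<integral>\<^sup>+ s\<in>{0..}. P0 s (J (occ n f)) z \<partial>lborel)"
proof -
  have "occ (Suc n) f z =
      (\<integral>\<^sup>+ t. (\<integral>\<^sup>+ s. P0 s (J (K n (t - s) f)) z * indicator {0..t} s * indicator {0..} t \<partial>lborel) \<partial>lborel)"
    unfolding occ_def K.simps by (subst nn_integral_multc) simp_all
  also have "\<dots> = (\<integral>\<^sup>+ s. (\<integral>\<^sup>+ t. P0 s (J (K n (t - s) f)) z * indicator {0..t} s * indicator {0..} t \<partial>lborel) \<partial>lborel)"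
    by (rule lborel_pair.Fubini') (unfold indicator_def atLeastAtMost_iff, measurable)
  also have "\<dots> = (\<integral>\<^sup>+ s. (\<integral>\<^sup>+ u\<in>{0..}. P0 s (J (K n u f)) z \<partial>lborel) * indicator {0..} s \<partial>lborel)"
  proof (rule nn_integral_cong)
    fix s :: real
    have "(\<integral>\<^sup>+ t. P0 s (J (K n (t - s) f)) z * indicator {0..t} s * indicator {0..} t \<partial>lborel) =
      (\<integral>\<^sup>+ u. P0 s (J (K n (s + u - s) f)) z * indicator {0..s + u} s * indicator {0..} (s + u) \<partial>lborel)"
      by (rule nn_integral_lborel_shift[symmetric]) (unfold indicator_def atLeastAtMost_iff, measurable)
    also have "\<dots> = (\<integral>\<^sup>+ u. P0 s (J (K n u f)) z * indicator {0..} u * indicator {0..} s \<partial>lborel)"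
      by (intro nn_integral_cong) (auto simp: indicator_def)
    also have "\<dots> = (\<integral>\<^sup>+ u\<in>{0..}. P0 s (J (K n u f)) z \<partial>lborel) * indicator {0..} s"
      by (rule nn_integral_multc) measurable
    finally show "(\<integral>\<^sup>+ t. P0 s (J (K n (t - s) f)) z * indicator {0..t} s * indicator {0..} t \<partial>lborel) =
      (\<integral>\<^sup>+ u\<in>{0..}. P0 s (J (K n u f)) z \<partial>lborel) * indicator {0..} s" .
  qed
  also have "\<dots> = (\<integral>\<^sup>+ s\<in>{0..}. P0 s (J (occ n f)) z \<partial>lborel)"
  proof (intro nn_integral_cong arg_cong2[where f="(*)"] refl)
    fix s :: real
    have "J (\<lambda>z. \<integral>\<^sup>+ u\<in>{0..}. K n u f z \<partial>lborel) = (\<lambda>z. \<integral>\<^sup>+ u\<in>{0..}. J (K n u f) z \<partial>lborel)"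
      by (rule ext, rule J_nn_integral) measurable
    moreover have "P0 s (\<lambda>z. \<integral>\<^sup>+ u\<in>{0..}. J (K n u f) z \<partial>lborel) z = (\<integral>\<^sup>+ u\<in>{0..}. P0 s (J (K n u f)) z \<partial>lborel)"
      by (rule P0_nn_integral) measurable
    ultimately show "(\<integral>\<^sup>+ u\<in>{0..}. P0 s (J (K n u f)) z \<partial>lborel) = P0 s (J (occ n f)) z"
      by (simp only: occ_def[abs_def])
  qed
  finally show ?thesis .
qed

lemma P0_eq_0_iff: "P0 s f z = 0 \<longleftrightarrow> f (flow s z) = 0"
  using survival_pos[of s z] by (simp add: P0_def ennreal_eq_0_iff not_le)

text \<open>Here \<open>lr > 0\<close> enters: every event rate and every jump probability is
  positive, so no velocity is lost.\<close>

lemma J_eq_0_iff: "J f z = 0 \<longleftrightarrow> (\<forall>w. f (fst z, w) = 0)"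
proof -
  have "jump_prob G lr (fst z) w \<le> 0 \<longleftrightarrow> False" for w
    using jump_prob_pos[of "fst z" w] by simp
  moreover have "ratez z \<le> 0 \<longleftrightarrow> False"
    using rate_pos[of "fst z" "snd z"] by simp
  ultimately show ?thesis
    by (simp only: J_def ennreal_eq_0_iff mult_eq_0_iff sum_eq_0_iff finite UNIV_I ball_UNIV simp_thms)
qed

lemma occ_Suc_eq_0_iff:
  assumes [measurable]: "f \<in> borel_measurable stateM"
  shows "occ (Suc n) f z = 0 \<longleftrightarrow> (AE s in lborel. 0 \<le> s \<longrightarrow> (\<forall>w. occ n f (fst (flow s z), w) = 0))"
  unfolding occ_Suc[OF assms]
  by (subst nn_integral_0_iff_AE) (auto simp: P0_eq_0_iff J_eq_0_iff indicator_def)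

text \<open>All velocities are included because a jump can produce any of them:
  \<open>occ (Suc n) f z\<close> vanishes exactly if the flight from \<open>z\<close> is in
  \<open>unreach n f\<close> at almost all nonnegative times.\<close>

definition unreach :: "nat \<Rightarrow> ((real^'d) \<times> ('d \<times> bool) \<Rightarrow> ennreal) \<Rightarrow> (real^'d) set" where
  "unreach n f = {x. \<forall>w. occ n f (x, w) = 0}"

lemma measurable_unreach [measurable (raw)]:
  assumes [measurable]: "f \<in> borel_measurable stateM" "g \<in> borel_measurable M"
  shows "Measurable.pred M (\<lambda>x. g x \<in> unreach n f)"
  unfolding unreach_def mem_Collect_eq by measurable

text \<open>Moving with velocity \<open>e\<^sub>i\<close> covers the right half line, moving with velocity \<open>-e\<^sub>i\<close> the left one,
  so a single jump spreads over a full line.\<close>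
lemma unreach_line:
  assumes [measurable]: "f \<in> borel_measurable stateM" and x: "x \<in> unreach (Suc n) f" and b: "b \<in> Basis"
  shows "AE r in lborel. x + r *\<^sub>R b \<in> unreach n f"
proof -
  obtain i where i: "b = axis i 1"
    using b by (auto simp: Basis_vec_def)
  have AE: "AE s in lborel. 0 \<le> s \<longrightarrow> x + s *\<^sub>R vel w \<in> unreach n f" for w
  proof -
    have "occ (Suc n) f (x, w) = 0"
      using x by (simp add: unreach_def del: split_paired_All)
    then show ?thesis
      unfolding occ_Suc_eq_0_iff[OF assms(1)] by (simp add: unreach_def flow_def)
  qed
  have "AE s in lborel. 0 \<le> s \<longrightarrow> x + s *\<^sub>R b \<in> unreach n f"
    using AE[of "(i, True)"] by (simp add: vel_def i)
  \<comment> \<open>Flying along \<open>- b\<close> for time \<open>- s\<close> reaches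
    \<open>x + s *\<^sub>R b\<close>, so the substitution covers the left half line.\<close>
  moreover have "AE s in lborel. 0 \<le> - s \<longrightarrow> x + (- s) *\<^sub>R vel (i, False) \<in> unreach n f"
    by (rule AE_lborel_uminus[OF AE])
  then have "AE s in lborel. s \<le> 0 \<longrightarrow> x + s *\<^sub>R b \<in> unreach n f"
    by (simp add: vel_def i)
  ultimately show ?thesis
    by eventually_elim linarith
qed

text \<open>Each coordinate costs one jump: \<open>unreach_line\<close> frees \<open>b\<close>, the
  induction hypothesis frees the rest from almost every point of that line, and
  \<open>AE_PiM_insert\<close> joins the two.\<close>

lemma unreach_span:
  assumes [measurable]: "f \<in> borel_measurable stateM"
    and "finite I" "I \<subseteq> Basis" "x \<in> unreach (card I + n) f"
  shows "AE r in PiM I (\<lambda>_. lborel). x + (\<Sum>b\<in>I. r b *\<^sub>R b) \<in> unreach n f"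
  using assms(2-)
proof (induction I arbitrary: x rule: finite_induct)
  case empty
  then show ?case by simp
next
  case (insert b I)
  show ?case
  proof (rule AE_PiM_insert[OF insert.hyps])
    show "Measurable.pred (PiM (insert b I) (\<lambda>_. lborel)) (\<lambda>r. x + (\<Sum>b\<in>insert b I. r b *\<^sub>R b) \<in> unreach n f)"
      by measurable
    have "x \<in> unreach (Suc (card I + n)) f" "b \<in> Basis"
      using insert by auto
    from unreach_line[OF assms(1) this]
    show "AE y in lborel. AE r in PiM I (\<lambda>_. lborel). x + (\<Sum>b'\<in>insert b I. (r(b := y)) b' *\<^sub>R b') \<in> unreach n f"
    proof eventually_elim
      case (elim y)
      have "AE r in PiM I (\<lambda>_. lborel). x + y *\<^sub>R b + (\<Sum>b\<in>I. r b *\<^sub>R b) \<in> unreach n f"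
        using insert elim by (intro insert.IH) auto
      moreover have "(\<Sum>b'\<in>insert b I. (r(b := y)) b' *\<^sub>R b') = y *\<^sub>R b + (\<Sum>b\<in>I. r b *\<^sub>R b)" for r
      proof -
        have "(\<Sum>b'\<in>I. (r(b := y)) b' *\<^sub>R b') = (\<Sum>b\<in>I. r b *\<^sub>R b)"
          using insert.hyps by (intro sum.cong) auto
        then show ?thesis using insert.hyps by simp
      qed
      ultimately show ?case by (simp add: add.assoc)
    qed
  qed
qed

text \<open>Lebesgue measure is the image of the product measure over \<open>Basis\<close>, so
  freeing all coordinates covers almost every position; a translation removes the starting
  point.\<close>

lemma AE_unreach:
  assumes f [measurable]: "f \<in> borel_measurable stateM"
    and x: "x \<in> unreach (card (Basis :: (real^'d) set) + n) f"
  shows "AE y in lborel. y \<in> unreach n f"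
proof -
  have "AE r in PiM (Basis :: (real^'d) set) (\<lambda>_. lborel). x + (\<Sum>b\<in>Basis. r b *\<^sub>R b) \<in> unreach n f"
    by (rule unreach_span[OF f _ _ x]) auto
  then have "AE y in lborel. x + y \<in> unreach n f"
    by (subst lborel_eq, subst AE_distr_iff) auto
  from AE_lborel_shift[OF this, of "- x"] show ?thesis by simp
qed

text \<open>Vanishing spreads from the one state \<open>z\<close> to almost every position with
  every velocity. With no jump left, only the free flight remains, and it preserves
  \<open>stateM\<close>.\<close>

lemma emeasure_0_if_occ_0:
  assumes A [measurable]: "A \<in> sets stateM"
    and occ: "\<And>n. occ n (indicator A) z = 0"
  shows "emeasure stateM A = 0"
proof -
  let ?f = "indicator A :: (real^'d) \<times> ('d \<times> bool) \<Rightarrow> ennreal"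
  let ?n = "card (Basis :: (real^'d) set)"
  \<comment> \<open>The velocity of \<open>z\<close> is prescribed, so one jump beyond the dimension
    is spent to reach a position where all velocities are covered.\<close>
  have "\<exists>s\<ge>0. \<forall>w. occ ?n ?f (fst (flow s z), w) = 0"
    using occ[of "Suc ?n"] by (intro AE_lborel_ex_nonneg) (subst (asm) occ_Suc_eq_0_iff, auto)
  then obtain x where "x \<in> unreach (?n + 0) ?f"
    by (auto simp: unreach_def)
  then have AE: "AE y in lborel. y \<in> unreach 0 ?f"
    by (intro AE_unreach) auto
  have "(\<integral>\<^sup>+ y. occ 0 ?f (y, w) \<partial>lborel) = 0" for w
  proof -
    have "AE y in lborel. occ 0 ?f (y, w) = 0"
      using AE by eventually_elim (simp add: unreach_def del: split_paired_All)
    then show ?thesis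
      by (subst nn_integral_0_iff_AE) auto
  qed
  then have "0 = (\<integral>\<^sup>+ z. occ 0 ?f z \<partial>stateM)"
    by (simp add: nn_integral_stateM)
  also have "\<dots> = (\<integral>\<^sup>+ t. (\<integral>\<^sup>+ z. K 0 t ?f z * indicator {0..} t \<partial>stateM) \<partial>lborel)"
    unfolding occ_def by (rule lborel_stateM.Fubini') measurable
  also have "\<dots> = (\<integral>\<^sup>+ t\<in>{0..}. (\<integral>\<^sup>+ z. P0 t ?f z \<partial>stateM) \<partial>lborel)"
    by (simp add: nn_integral_multc)
  finally have "AE t in lborel. 0 \<le> t \<longrightarrow> (\<integral>\<^sup>+ z. P0 t ?f z \<partial>stateM) = 0"
    by (subst (asm) eq_commute, subst (asm) nn_integral_0_iff_AE) (auto simp: indicator_def)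
  \<comment> \<open>A single time suffices: survival is positive, so the indicator vanishes almost
    everywhere after flowing for time \<open>t\<close>.\<close>
  from AE_lborel_ex_nonneg[OF this]
  obtain t where "(\<integral>\<^sup>+ z. P0 t ?f z \<partial>stateM) = 0"
    by auto
  then have "AE z in stateM. ?f (flow t z) = 0"
    by (subst (asm) nn_integral_0_iff_AE) (auto simp: P0_eq_0_iff)
  then have "(\<integral>\<^sup>+ z. ?f (flow t z) \<partial>stateM) = 0"
    by (subst nn_integral_0_iff_AE) auto
  then show ?thesis
    by (subst (asm) nn_integral_stateM_flow) auto
qed

text \<open>The law of the process at an independent exponential time of rate 1. At a fixed time
  \<open>t\<close> only positions within distance \<open>t\<close> are reachable; averaging over all
  times removes this limit and keeps every invariant law invariant.\<close>

definition resolvent :: "(real^'d) \<times> ('d \<times> bool) \<Rightarrow> ((real^'d) \<times> ('d \<times> bool)) set \<Rightarrow> ennreal" where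
  "resolvent z A = (\<integral>\<^sup>+ t\<in>{0..}. ennreal (exp (- t)) * trans G lr t z A \<partial>lborel)"

lemma measurable_resolvent [measurable]:
  assumes [measurable]: "A \<in> sets stateM"
  shows "(\<lambda>z. resolvent z A) \<in> borel_measurable stateM"
  unfolding resolvent_def by measurable

lemma nn_integral_exp_Ici: "(\<integral>\<^sup>+ t\<in>{0..}. ennreal (exp (- t)) \<partial>lborel) = 1"
  using nn_intergal_power_times_exp_Ici[of 0] by simp

lemma resolvent_compl:
  assumes [measurable]: "A \<in> sets stateM"
  shows "resolvent z A + resolvent z (UNIV - A) = 1"
proof -
  have [measurable]: "UNIV - A \<in> sets stateM"
    using sets.compl_sets[OF assms] by simp
  have "resolvent z A + resolvent z (UNIV - A) =
    (\<integral>\<^sup>+ t. ennreal (exp (- t)) * trans G lr t z A * indicator {0..} t +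
      ennreal (exp (- t)) * trans G lr t z (UNIV - A) * indicator {0..} t \<partial>lborel)"
    unfolding resolvent_def by (rule nn_integral_add[symmetric]) measurable
  also have "\<dots> = (\<integral>\<^sup>+ t\<in>{0..}. ennreal (exp (- t)) \<partial>lborel)"
    by (intro nn_integral_cong) (auto simp: indicator_def trans_compl simp flip: distrib_left)
  finally show ?thesis by (simp add: nn_integral_exp_Ici)
qed

text \<open>Since \<open>exp (- t)\<close> is positive and the summands of \<open>trans\<close> are
  nonnegative, every occupation integral vanishes as well.\<close>

lemma emeasure_0_if_resolvent_0:
  assumes [measurable]: "A \<in> sets stateM" and 0: "resolvent z A = 0"
  shows "emeasure stateM A = 0"
proof (rule emeasure_0_if_occ_0)
  fix n
  have "AE t in lborel. 0 \<le> t \<longrightarrow> trans G lr t z A = 0"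
    using 0 unfolding resolvent_def
    by (subst (asm) nn_integral_0_iff_AE) (auto simp: indicator_def)
  then have "AE t in lborel. K n t (indicator A) z * indicator {0..} t = 0"
    by (elim eventually_mono) (auto simp: trans_eq indicator_def suminf_eq_zero_iff)
  then show "occ n (indicator A) z = 0"
    unfolding occ_def by (subst nn_integral_0_iff_AE) auto
qed (rule assms)

lemma invariant_resolvent:
  assumes inv: "invariant G lr \<mu>" and A [measurable]: "A \<in> sets stateM"
  shows "(\<integral>\<^sup>+ z. resolvent z A \<partial>\<mu>) = emeasure \<mu> A"
proof -
  have [measurable_cong]: "sets \<mu> = sets stateM" and "prob_space \<mu>"
    and trans: "\<And>t. 0 \<le> t \<Longrightarrow> (\<integral>\<^sup>+ z. trans G lr t z A \<partial>\<mu>) = emeasure \<mu> A"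
    using inv A by (auto simp: invariant_def)
  interpret prob_space \<mu> by fact
  interpret pair_sigma_finite lborel \<mu> ..
  have "(\<integral>\<^sup>+ z. resolvent z A \<partial>\<mu>) =
    (\<integral>\<^sup>+ t. (\<integral>\<^sup>+ z. ennreal (exp (- t)) * trans G lr t z A * indicator {0..} t \<partial>\<mu>) \<partial>lborel)"
    unfolding resolvent_def by (rule Fubini') measurable
  also have "\<dots> = (\<integral>\<^sup>+ t. ennreal (exp (- t)) * indicator {0..} t * emeasure \<mu> A \<partial>lborel)"
    by (intro nn_integral_cong)
       (auto simp: nn_integral_cmult nn_integral_multc trans indicator_def)
  also have "\<dots> = emeasure \<mu> A"
    by (subst nn_integral_multc) (auto simp: nn_integral_exp_Ici)
  finally show ?thesis .
qed

lemma emeasure_stateM_UNIV: "emeasure (stateM :: ((real^'d) \<times> ('d \<times> bool)) measure) UNIV \<noteq> 0"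
  using nn_integral_stateM[of "\<lambda>_ :: (real^'d) \<times> ('d \<times> bool). 1"] by simp

text \<open>\<open>resolvent\<close> is irreducible: \<open>stateM\<close> is not the zero measure,
  so \<open>A\<close> or its complement is not null, and a set that is not null is charged from
  every state.\<close>

theorem invariant_unique:
  assumes "invariant G lr \<mu>" "invariant G lr \<nu>"
  shows "\<mu> = \<nu>"
proof (rule invariant_unique_if_irreducible[where R=resolvent])
  have sets: "sets \<mu> = sets stateM" "sets \<nu> = sets stateM"
    using assms by (auto simp: invariant_def)
  then have space: "space \<mu> = UNIV"
    by (metis sets_eq_imp_space_eq space_stateM)
  show "prob_space \<mu>" "prob_space \<nu>" "sets \<nu> = sets \<mu>"
    using assms sets by (auto simp: invariant_def)
  fix A assume "A \<in> sets \<mu>"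
  then have A [measurable]: "A \<in> sets stateM" by (simp add: sets)
  show "(\<lambda>z. resolvent z A) \<in> borel_measurable \<mu>"
    using measurable_resolvent[OF A] sets(1) by (simp cong: measurable_cong_sets)
  show "resolvent z A + resolvent z (space \<mu> - A) = 1" for z
    by (simp add: space resolvent_compl)
  show "(\<integral>\<^sup>+ z. resolvent z A \<partial>\<mu>) = emeasure \<mu> A" "(\<integral>\<^sup>+ z. resolvent z A \<partial>\<nu>) = emeasure \<nu> A"
    by (intro invariant_resolvent assms A)+
  have A' [measurable]: "UNIV - A \<in> sets stateM"
    using sets.compl_sets[OF A] by simp
  have "emeasure stateM A + emeasure stateM (UNIV - A) = emeasure stateM (A \<union> (UNIV - A))"
    by (subst plus_emeasure) auto
  then consider "emeasure stateM A \<noteq> 0" | "emeasure stateM (UNIV - A) \<noteq> 0"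
    using emeasure_stateM_UNIV by fastforce
  then show "(\<forall>z\<in>space \<mu>. 0 < resolvent z A) \<or> (\<forall>z\<in>space \<mu>. 0 < resolvent z (space \<mu> - A))"
  proof cases
    case 1
    then have "resolvent z A \<noteq> 0" for z
      using emeasure_0_if_resolvent_0[OF A] by metis
    then show ?thesis by (simp add: zero_less_iff_neq_zero)
  next
    case 2
    then have "resolvent z (UNIV - A) \<noteq> 0" for z
      using emeasure_0_if_resolvent_0[OF A'] by metis
    then show ?thesis by (simp add: zero_less_iff_neq_zero space)
  qed
qed

end

theorem theorem3:
  fixes U :: "(real^'d::finite) \<Rightarrow> real"
    and G :: "(real^'d) \<Rightarrow> (real^'d)"
    and lr :: real
  assumes U_nonneg: "\<forall>x. 0 \<le> U x"
    and U_grad: "\<forall>x. (U has_derivative (\<lambda>h. G x \<bullet> h)) (at x)"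
    and G_cont: "continuous_on UNIV G"
    and U_int: "integrable lborel (\<lambda>x. exp (- U x))"
    and lr_pos: "lr > 0"
  shows "invariant G lr (rho U) \<and> (\<forall>\<mu>. invariant G lr \<mu> \<longrightarrow> \<mu> = rho U)"
proof -
  interpret coordinate_sampler_potential G lr U
    using U_grad G_cont lr_pos by unfold_locales auto
  have "invariant G lr (rho U)"
    by (rule invariant_rho[OF U_int])
  then show ?thesis
    using invariant_unique by blast
qed

end
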